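(* Let $T$ be a parsing of $n_o\ge2$ options with $n_i$ internal nodes, and let $\Gamma_T$ be the isomorphism group of $T$. Let $\dot{\mathbf m}=f_m(\mathbf m,\mathbf v)$ be the tree dynamics defined by $T$, and let $v_i=v>1$ for each option $i\in\{1,\dots,n_o\}$. Then: (i) The vector field $f_m$ has an equilibrium $\mathbf m=\bar m\,\mathbf 1_{2n_i}$, where $$\bar m=\frac{-(1+v^2)+\sqrt{1+2v^2+4\sigma v^3+9v^4}}{2v(2v+\sigma)}.$$ (ii) The vector field has a singularity at $(\mathbf m,v,\sigma)=(\bar m\mathbf 1_{2n_i},v,\sigma)$, where $\sigma$ and $v$ are related by $$\sigma=\frac{4v^3}{(v^2-1)^2}.$$ The singularity is a $\Gamma_T$-equivariant bifurcation that consists of $n_i$ copies of the standard $S_2$ pitchfork bifurcation. (iii) When $\mathbf v$ is perturbed away from $\mathbf v=v\mathbf 1$, the system $f_m(\mathbf m,\mathbf v)$ is an $(n_o-1)$-parameter unfolding of the $\Gamma_T$-equivariant bifurcation.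
   Context: Seeley et al. dynamics: for $\mathbf m=(m_1,m_2)$, $\mathbf v=(v_1,v_2)$ with $v_1,v_2>0$, and a constant $\sigma>0$, $\dot{\mathbf m}=f(\mathbf m,\mathbf v)$ is $\dot m_i=v_i m_U-m_i\left(\frac1{v_i}-v_i m_U+\sigma(1-m_i-m_U)\right)$, $i=1,2$, with $m_U=1-m_1-m_2$. When $v_1=v_2$ this is equivariant under the swap $S_2$ of the two coordinates. A parsing of $n_o$ options is a proper rooted binary tree $T$ (each internal node $i$ has a left child $\mathrm{lc}(i)$ and a right child $\mathrm{rc}(i)$) whose leaves represent the options; $o(i)$ is the option of leaf $i$. Given option values $v_1,\dots,v_{n_o}>0$, each node $i$ has value $u_i=v_{o(i)}$ if $i$ is a leaf and $u_i=(u_{\mathrm{lc}(i)}+u_{\mathrm{rc}(i)})/2$ if $i$ is internal. Each internal node $i$ has value vector $\mathbf v_i=(v_{i1},v_{i2})=(u_{\mathrm{lc}(i)},u_{\mathrm{rc}(i)})$ and state $\mathbf m_i=(m_{i1},m_{i2})$ (with $(m_{i1},m_{i2},1-m_{i1}-m_{i2})$ in the 2-simplex). The vectors $\mathbf m,\mathbf v\in\mathbb R^{2n_i}$ stack $\mathbf m_i,\mathbf v_i$ over internal nodes in depth-first order, and $f_m(\mathbf m,\mathbf v)$ stacks the $f(\mathbf m_i,\mathbf v_i)$ in the same order. $\mathbf 1_k\in\mathbb R^k$ is the all-ones vector. An isomorphism of $T$ is a bijection of the node set to itself that fixes the root and preserves edges in both directions; these form the group $\Gamma_T$. It acts on $\mathbb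 R^{2n_i}$ by permuting coordinates, which are indexed by non-root nodes (the two coordinates of block $i$ correspond to $\mathrm{lc}(i)$, $\mathrm{rc}(i)$): the coordinate of $\gamma x$ at node $\gamma(j)$ is the coordinate of $x$ at node $j$. Equivariance means $F(\gamma x,\lambda)=\gamma F(x,\lambda)$ for all $\gamma\in\Gamma_T$. A singularity is an equilibrium at which the Jacobian in $\mathbf m$ is singular. The standard $S_2$ pitchfork is the bifurcation of $\dot x=x(\mu-x^2)$ at $\mu=0$; "$n_i$ copies" refers to one pitchfork, in the bifurcation parameter $\sigma$ (or equivalently $v$), in each of the $n_i$ diagonal blocks $\dot{\mathbf m}_i=f(\mathbf m_i,\mathbf v_i)$ of the system. If $f(x,\lambda)=0$ undergoes a bifurcation as $\lambda$ is varied, a $k$-parameter unfolding of $f$ is a parametrized family $F(x,\lambda,\alpha)$, $\alpha\in\mathbb R^k$, with $F(x,\lambda,0)=f(x,\lambda)$. The unfolding parameters here are $\alpha_i=2(v_{i1}-v_{i2})/(v_{i1}+v_{i2})$, one for each internal node $i$. *)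

theory Defs
  imports "HOL-Analysis.Analysis"
begin

section \<open>Parsings\<close>

text \<open>The internal nodes are the elements of the finite type \<open>'i\<close>, the leaves those of
  \<open>'l\<close> and the options those of \<open>'o\<close>, so that $n_i$ and $n_o$ are \<open>CARD('i)\<close> and
  \<open>CARD('o)\<close>; a node is an element of \<open>'i + 'l\<close>.\<close>

record ('i, 'l, 'o) parsing =
  root_node :: "'i + 'l"
  lc :: "'i \<Rightarrow> 'i + 'l"
  rc :: "'i \<Rightarrow> 'i + 'l"
  opt :: "'l \<Rightarrow> 'o"

text \<open>The pair \<open>(i, 1)\<close> addresses the left child of \<open>i\<close> and \<open>(i, 2)\<close> the right child.
  In a tree, \<open>child\<close> is a bijection from such pairs to the non-root nodes; it is the
  identification of the coordinates of $\mathbb{R}^{2n_i}$ with the non-root nodes.\<close>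

definition child :: "('i, 'l, 'o) parsing \<Rightarrow> 'i \<times> 2 \<Rightarrow> 'i + 'l" where
  "child T c = (if snd c = 1 then lc T (fst c) else rc T (fst c))"

definition edges :: "('i, 'l, 'o) parsing \<Rightarrow> (('i + 'l) \<times> ('i + 'l)) set" where
  "edges T = {(Inl (fst c), child T c) | c. True}"

text \<open>A proper rooted binary tree: injectivity of \<open>child\<close> says that the two children of a
  node differ and that no node has two parents. Internal nodes have two children and
  leaves none by construction.\<close>

definition is_parsing :: "('i, 'l, 'o) parsing \<Rightarrow> bool" where
  "is_parsing T \<longleftrightarrow>
     inj (child T) \<and>
     root_node T \<notin> range (child T) \<and>
     (\<forall>n. (root_node T, n) \<in> (edges T)\<^sup>*) \<and>
     bij (opt T)"

text \<open>The node values: the solution $u$ of the recursion from the leaves to the root, which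
  exists and is unique for a parsing.\<close>

definition node_value ::
    "('i, 'l, 'o::finite) parsing \<Rightarrow> real^'o \<Rightarrow> 'i + 'l \<Rightarrow> real" where
  "node_value T w = (THE u. (\<forall>l. u (Inr l) = w $ opt T l) \<and>
                            (\<forall>i. u (Inl i) = (u (lc T i) + u (rc T i)) / 2))"

text \<open>The stacked value vector $\mathbf{v}$; its block \<open>i\<close> is $(u_{lc(i)}, u_{rc(i)})$.\<close>

definition value_vec ::
    "('i::finite, 'l, 'o::finite) parsing \<Rightarrow> real^'o \<Rightarrow> real^('i \<times> 2)" where
  "value_vec T w = (\<chi> c. node_value T w (child T c))"

definition alpha :: "('i::finite, 'l, 'o::finite) parsing \<Rightarrow> real^'o \<Rightarrow> real^'i" where
  "alpha T w = (\<chi> i. 2 * (value_vec T w $ (i, 1) - value_vec T w $ (i, 2)) /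
                        (value_vec T w $ (i, 1) + value_vec T w $ (i, 2)))"


section \<open>Dynamics\<close>

definition seeley :: "real \<Rightarrow> real^2 \<Rightarrow> real^2 \<Rightarrow> real^2" where
  "seeley \<sigma> m v = (\<chi> k. let mU = 1 - m $ 1 - m $ 2 in
     v $ k * mU - m $ k * (1 / v $ k - v $ k * mU + \<sigma> * (1 - m $ k - mU)))"

definition block :: "'i::finite \<Rightarrow> real^('i \<times> 2) \<Rightarrow> real^2" where
  "block i x = (\<chi> k. x $ (i, k))"

text \<open>Each $(m_{i1}, m_{i2}, 1 - m_{i1} - m_{i2})$ lies in the 2-simplex.\<close>

definition state_space :: "(real^('i::finite \<times> 2)) set" where
  "state_space = {m. \<forall>i. 0 \<le> m $ (i, 1) \<and> 0 \<le> m $ (i, 2) \<and> m $ (i, 1) + m $ (i, 2) \<le> 1}"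

definition tree_field ::
    "real \<Rightarrow> real^('i \<times> 2) \<Rightarrow> real^('i::finite \<times> 2) \<Rightarrow> real^('i \<times> 2)" where
  "tree_field \<sigma> m v = (\<chi> c. seeley \<sigma> (block (fst c) m) (block (fst c) v) $ snd c)"

definition mbar :: "real \<Rightarrow> real \<Rightarrow> real" where
  "mbar v \<sigma> = (- (1 + v^2) + sqrt (1 + 2 * v^2 + 4 * \<sigma> * v^3 + 9 * v^4)) /
              (2 * v * (2 * v + \<sigma>))"

definition singularity :: "(real^'n \<Rightarrow> real^'n) \<Rightarrow> real^'n::finite \<Rightarrow> bool" where
  "singularity F x \<longleftrightarrow> F x = 0 \<and> F differentiable (at x) \<and> det (jacobian F (at x)) = 0"


section \<open>Tree isomorphisms and equivariance\<close>

definition tree_isos :: "('i, 'l, 'o) parsing \<Rightarrow> ('i + 'l \<Rightarrow> 'i + 'l) set" where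
  "tree_isos T = {\<gamma>. bij \<gamma> \<and> \<gamma> (root_node T) = root_node T \<and>
                     (\<forall>a b. (a, b) \<in> edges T \<longleftrightarrow> (\<gamma> a, \<gamma> b) \<in> edges T)}"

text \<open>The coordinate of \<open>act T \<gamma> x\<close> at the node \<open>\<gamma> j\<close> is the coordinate of \<open>x\<close> at \<open>j\<close>.\<close>

definition act ::
    "('i::finite, 'l, 'o) parsing \<Rightarrow> ('i + 'l \<Rightarrow> 'i + 'l) \<Rightarrow> real^('i \<times> 2) \<Rightarrow> real^('i \<times> 2)"
  where "act T \<gamma> x = (\<chi> c. x $ inv (child T) (inv \<gamma> (child T c)))"

definition tree_equivariant ::
    "('i::finite, 'l, 'o) parsing \<Rightarrow> (real^('i \<times> 2) \<Rightarrow> 'p \<Rightarrow> real^('i \<times> 2)) \<Rightarrow> bool" where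
  "tree_equivariant T F \<longleftrightarrow>
     (\<forall>\<gamma>\<in>tree_isos T. \<forall>x l. F (act T \<gamma> x) l = act T \<gamma> (F x l))"


section \<open>Bifurcations\<close>

text \<open>$C^k$ and $C^\infty$ functions on an open set.\<close>

primrec Ck_on ::
    "nat \<Rightarrow> 'a::real_normed_vector set \<Rightarrow> ('a \<Rightarrow> 'b::real_normed_vector) \<Rightarrow> bool" where
  "Ck_on 0 U f \<longleftrightarrow> continuous_on U f"
| "Ck_on (Suc k) U f \<longleftrightarrow>
     (\<forall>x\<in>U. f differentiable (at x)) \<and>
     (\<forall>h. Ck_on k U (\<lambda>x. frechet_derivative f (at x) h))"

definition smooth_on ::
    "'a::real_normed_vector set \<Rightarrow> ('a \<Rightarrow> 'b::real_normed_vector) \<Rightarrow> bool" where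
  "smooth_on U f \<longleftrightarrow> (\<forall>k. Ck_on k U f)"

text \<open>Equivalence of bifurcation problems with symmetry group \<open>G\<close>, in the sense of
  Golubitsky, Stewart and Schaeffer: near \<open>(x0, l0)\<close>,
  $g(x,\lambda) = S(x,\lambda)\, h(\Phi(x,\lambda), \Lambda(\lambda))$, where
  $\Lambda' > 0$, the data are \<open>G\<close>-equivariant, and $S$ and $d_x\Phi$ lie at the base point in
  the identity component of the group of invertible \<open>G\<close>-equivariant matrices.\<close>

definition equivariant_GL0 :: "(real^'n^'n) set \<Rightarrow> (real^'n^'n::finite) set" where
  "equivariant_GL0 G =
     connected_component_set {M. invertible M \<and> (\<forall>\<gamma>\<in>G. M ** \<gamma> = \<gamma> ** M)} (mat 1)"

definition bifurcation_equiv ::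
    "(real^'n^'n) set \<Rightarrow> (real^'n \<Rightarrow> real \<Rightarrow> real^'n) \<Rightarrow> real^'n \<Rightarrow> real \<Rightarrow>
     (real^'n \<Rightarrow> real \<Rightarrow> real^'n) \<Rightarrow> real^'n \<Rightarrow> real \<Rightarrow> bool" where
  "bifurcation_equiv G g x0 l0 h y0 \<mu>0 \<longleftrightarrow>
     (\<exists>A B \<Phi> \<Lambda> S.
        open A \<and> open B \<and> x0 \<in> A \<and> l0 \<in> B \<and>
        smooth_on (A \<times> B) (\<lambda>(x, l). \<Phi> x l) \<and> smooth_on B \<Lambda> \<and>
        smooth_on (A \<times> B) (\<lambda>(x, l). S x l) \<and>
        \<Phi> x0 l0 = y0 \<and> \<Lambda> l0 = \<mu>0 \<and> deriv \<Lambda> l0 > 0 \<and>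
        jacobian (\<lambda>x. \<Phi> x l0) (at x0) \<in> equivariant_GL0 G \<and>
        S x0 l0 \<in> equivariant_GL0 G \<and>
        (\<forall>\<gamma>\<in>G. \<forall>x\<in>A. \<gamma> *v x \<in> A \<and>
           (\<forall>l\<in>B. \<Phi> (\<gamma> *v x) l = \<gamma> *v \<Phi> x l \<and> S (\<gamma> *v x) l ** \<gamma> = \<gamma> ** S x l)) \<and>
        (\<forall>x\<in>A. \<forall>l\<in>B. g x l = S x l *v h (\<Phi> x l) (\<Lambda> l)))"

definition S2 :: "(real^2^2) set" where
  "S2 = {mat 1, vector [vector [0, 1], vector [1, 0]]}"

text \<open>The standard pitchfork as a planar \<open>S2\<close>-equivariant problem. With
  $a = (x_1 - x_2)/2$, on which the swap acts by $-1$, and $b = (x_1 + x_2)/2$, this is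
  $\dot a = a(\mu - a^2)$, $\dot b = -b$: the pitchfork in the antisymmetric direction,
  augmented by a linear contraction in the direction that plays no part in the bifurcation.\<close>

definition pitchfork_nf :: "real^2 \<Rightarrow> real \<Rightarrow> real^2" where
  "pitchfork_nf x \<mu> =
     (let a = (x $ 1 - x $ 2) / 2; b = (x $ 1 + x $ 2) / 2
      in vector [a * (\<mu> - a^2) - b, - (a * (\<mu> - a^2)) - b])"

definition S2_pitchfork :: "(real^2 \<Rightarrow> real \<Rightarrow> real^2) \<Rightarrow> real^2 \<Rightarrow> real \<Rightarrow> bool" where
  "S2_pitchfork g x0 l0 \<longleftrightarrow> bifurcation_equiv S2 g x0 l0 pitchfork_nf 0 0"

text \<open>A tree-equivariant family that decouples into the blocks of the internal nodes, each
  undergoing the pitchfork at the same parameter value.\<close>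

definition equivariant_pitchfork_copies ::
    "('i::finite, 'l, 'o) parsing \<Rightarrow> (real^('i \<times> 2) \<Rightarrow> real \<Rightarrow> real^('i \<times> 2)) \<Rightarrow>
     real^('i \<times> 2) \<Rightarrow> real \<Rightarrow> bool" where
  "equivariant_pitchfork_copies T F x0 l0 \<longleftrightarrow>
     tree_equivariant T F \<and>
     (\<exists>g. \<forall>i. (\<forall>x l. block i (F x l) = g i (block i x) l) \<and>
              S2_pitchfork (g i) (block i x0) l0)"

text \<open>\<open>F\<close> is a \<open>CARD('k)\<close>-parameter unfolding of \<open>f\<close>, for bifurcation parameters in \<open>L\<close>
  and unfolding parameters in the neighbourhood \<open>A\<close> of 0.\<close>

definition unfolding_on ::
    "'p::real_normed_vector set \<Rightarrow> (real^'k) set \<Rightarrow>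
     ('x::real_normed_vector \<Rightarrow> 'p \<Rightarrow> 'y::real_normed_vector) \<Rightarrow>
     ('x \<Rightarrow> 'p \<Rightarrow> real^'k::finite \<Rightarrow> 'y) \<Rightarrow> bool" where
  "unfolding_on L A f F \<longleftrightarrow>
     open L \<and> open A \<and> 0 \<in> A \<and>
     smooth_on (UNIV \<times> L \<times> A) (\<lambda>(x, l, \<alpha>). F x l \<alpha>) \<and>
     (\<forall>x. \<forall>l\<in>L. F x l 0 = f x l)"

end

theory Submission
  imports Defs
begin

text \<open>With equal option values the system decouples into identical planar blocks. In the coordinates
  $a = (m_1 - m_2)/2$, $b = (m_1 + m_2)/2$ a block reads
  $\dot a = a\,(v(1-2b) - 1/v)$, $\dot b = v - (v + 1/v) b - (2v+\sigma) b^2 + \sigma a^2$.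
  At $a = 0$ the second equation has the positive zero $\bar m$, and the Jacobian there is singular
  exactly when $v(1 - 2\bar m) = 1/v$; substituting $\bar m = (v^2-1)/(2v^2)$ into the quadratic
  equation yields the critical $\sigma$ (\<open>mbar_properties\<close>, \<open>mbar_critical\<close>).

  The pitchfork equivalence can be written down explicitly. Solving $\dot b = 0$ for $b$ gives a
  square root $\beta(a^2)$, and since the growth rate of $a$ is affine in $b$, the first equation is
  $\dot a = a\,(p_0 - q^2 a^2) + (\ldots)\,\dot b$, where
  $p_0 = v(1 - 2\bar m) - 1/v$ and $q > 0$ has a closed form (\<open>pitchfork_factorization\<close>).
  Hence $(a, b) \mapsto (a q, -\dot b)$ and the parameter $p_0$ transform the block into the normal
  form. That the derivatives of $p_0$ in $\sigma$ and in $v$ are positive at the singularity follows by implicit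
  differentiation of the equation of $\bar m$ (\<open>pitchfork_speed\<close>, \<open>S2_pitchfork_seeley\<close>).
  Equivariance holds because a tree isomorphism permutes the blocks and possibly swaps the two
  coordinates within a block (\<open>tree_equivariant_uniform\<close>).

  For the unfolding, the two children of a node with value $u_i$ have the values
  $u_i (1 \pm \alpha_i/2)$. Going down from the root, all values are polynomials in the value of
  the root and the $\alpha_i$, and any positive root value together with any $|\alpha_i| < 2$ arises
  from exactly one choice of positive option values (\<open>bij_betw_root_alpha\<close>). Counting children gives
  $n_i = n_o - 1$.\<close>

section \<open>Calculus of smooth functions\<close>

lemma Ck_on_SucD:
  assumes "Ck_on (Suc k) U f" "x \<in> U"
  shows "(f has_derivative frechet_derivative f (at x)) (at x)"
  using assms by (simp add: frechet_derivative_works)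

lemma Ck_on_cong:
  assumes "open U" "\<And>x. x \<in> U \<Longrightarrow> f x = g x" "Ck_on k U f"
  shows "Ck_on k U g"
  using assms(2,3)
proof (induction k arbitrary: f g)
  case 0
  then show ?case by (simp cong: continuous_on_cong)
next
  case (Suc k)
  have eq: "frechet_derivative f (at x) = frechet_derivative g (at x)" if "x \<in> U" for x
    by (rule frechet_derivative_transform_within_open[of _ _ U])
      (use Suc.prems that \<open>open U\<close> in simp_all)
  have "g differentiable (at x)" if "x \<in> U" for x
    using has_derivative_transform_within_open[OF Ck_on_SucD[OF Suc.prems(2) that] \<open>open U\<close> that]
      Suc.prems(1) by (auto simp: differentiable_def)
  moreover have "Ck_on k U (\<lambda>x. frechet_derivative g (at x) h)" for h
    by (rule Suc.IH[where f = "\<lambda>x. frechet_derivative f (at x) h"]) (use Suc.prems(2) eq in auto)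
  ultimately show ?case by simp
qed

text \<open>For an open set, the recursive clause may be checked with any explicit form of the derivative.\<close>

lemma Ck_on_SucI:
  assumes "open U" "\<And>x. x \<in> U \<Longrightarrow> (f has_derivative f' x) (at x)"
    and "\<And>h. Ck_on k U (\<lambda>x. f' x h)"
  shows "Ck_on (Suc k) U f"
proof -
  have "f' x = frechet_derivative f (at x)" if "x \<in> U" for x
    using frechet_derivative_at[OF assms(2)[OF that]] .
  then have "Ck_on k U (\<lambda>x. frechet_derivative f (at x) h)" for h
    using Ck_on_cong[OF assms(1) _ assms(3)[of h]] by simp
  then show ?thesis
    using assms(2) by (auto simp: differentiable_def)
qed

lemma Ck_on_Suc_imp_Ck_on: "Ck_on (Suc k) U f \<Longrightarrow> Ck_on k U f"
proof (induction k arbitrary: f)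
  case 0
  then show ?case
    by (auto intro!: continuous_at_imp_continuous_on differentiable_imp_continuous_within)
next
  case (Suc k)
  show ?case
    using Suc.prems Suc.IH by (metis Ck_on.simps(2))
qed

lemma Ck_on_const: "open U \<Longrightarrow> Ck_on k U (\<lambda>x. a)"
proof (induction k arbitrary: a)
  case (Suc k)
  show ?case
    by (rule Ck_on_SucI[where f' = "\<lambda>x h. 0"]) (use Suc in auto)
qed auto

lemma Ck_on_bounded_linear:
  assumes "open U" "bounded_linear f"
  shows "Ck_on k U f"
proof (cases k)
  case 0
  then show ?thesis
    using assms by (simp add: linear_continuous_on)
next
  case (Suc j)
  show ?thesis
    unfolding Suc by (rule Ck_on_SucI[where f' = "\<lambda>x. f"])
      (use assms in \<open>auto intro: bounded_linear_imp_has_derivative Ck_on_const\<close>)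
qed

lemma Ck_on_linear_compose:
  assumes "open U" "bounded_linear L" "Ck_on k U f"
  shows "Ck_on k U (\<lambda>x. L (f x))"
  using assms(3)
proof (induction k arbitrary: f)
  case 0
  then show ?case
    using assms(2) by (auto intro: bounded_linear.continuous_on)
next
  case (Suc k)
  show ?case
    by (rule Ck_on_SucI[where f' = "\<lambda>x h. L (frechet_derivative f (at x) h)"])
      (use Suc assms(1) in \<open>auto intro: bounded_linear.has_derivative[OF assms(2)]
        Ck_on_SucD[OF Suc.prems] simp del: Ck_on.simps(2), simp\<close>)
qed

lemma Ck_on_compose_linear:
  assumes "open U" "open W" "bounded_linear L" "L ` W \<subseteq> U" "Ck_on k U f"
  shows "Ck_on k W (\<lambda>x. f (L x))"
  using assms(5)
proof (induction k arbitrary: f)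
  case 0
  then show ?case
    using assms continuous_on_compose2[of U f W L] by (auto simp: linear_continuous_on)
next
  case (Suc k)
  have "((\<lambda>x. f (L x)) has_derivative (\<lambda>h. frechet_derivative f (at (L x)) (L h))) (at x)"
    if "x \<in> W" for x
    using has_derivative_compose[OF bounded_linear_imp_has_derivative[OF assms(3)]
        Ck_on_SucD[OF Suc.prems, of "L x"]] that assms(4) by auto
  then show ?case
    by (rule Ck_on_SucI[OF assms(2)]) (use Suc in auto)
qed

lemma Ck_on_add:
  assumes "open U" "Ck_on k U f" "Ck_on k U g"
  shows "Ck_on k U (\<lambda>x. f x + g x)"
  using assms(2,3)
proof (induction k arbitrary: f g)
  case 0
  then show ?case by (auto intro: continuous_on_add)
next
  case (Suc k)
  show ?case
    by (rule Ck_on_SucI[where f' = "\<lambda>x h. frechet_derivative f (at x) h + frechet_derivative g (at x) h"])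
      (use Suc assms(1) in \<open>auto intro: has_derivative_add Ck_on_SucD[OF Suc.prems(1)]
        Ck_on_SucD[OF Suc.prems(2)] simp del: Ck_on.simps(2), simp\<close>)
qed

lemma Ck_on_bilinear:
  assumes "open U" "bounded_bilinear B" "Ck_on k U f" "Ck_on k U g"
  shows "Ck_on k U (\<lambda>x. B (f x) (g x))"
  using assms(3,4)
proof (induction k arbitrary: f g)
  case 0
  then show ?case using assms(2) by (auto intro: bounded_bilinear.continuous_on)
next
  case (Suc k)
  show ?case
  proof (rule Ck_on_SucI[OF assms(1)])
    show "((\<lambda>x. B (f x) (g x)) has_derivative
        (\<lambda>h. B (f x) (frechet_derivative g (at x) h) + B (frechet_derivative f (at x) h) (g x))) (at x)"
      if "x \<in> U" for x
      by (intro bounded_bilinear.FDERIV[OF assms(2)] Ck_on_SucD[OF Suc.prems(1) that]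
          Ck_on_SucD[OF Suc.prems(2) that])
    show "Ck_on k U (\<lambda>x. B (f x) (frechet_derivative g (at x) h) +
        B (frechet_derivative f (at x) h) (g x))" for h
      using Suc.prems Suc.prems[THEN Ck_on_Suc_imp_Ck_on]
      by (intro Ck_on_add assms(1) Suc.IH) simp_all
  qed
qed

text \<open>The derivative of \<open>f powr a\<close> is \<open>f powr (a - 1)\<close> times a multiple of the derivative of
  \<open>f\<close>, so one induction over all exponents covers quotients and square roots.\<close>

lemma Ck_on_powr:
  fixes f :: "'a::real_normed_vector \<Rightarrow> real"
  assumes "open U" "\<And>x. x \<in> U \<Longrightarrow> f x > 0" "Ck_on k U f"
  shows "Ck_on k U (\<lambda>x. f x powr a)"
  using assms(3)
proof (induction k arbitrary: a)
  case 0
  then show ?case using assms(2) by (force intro!: continuous_intros)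
next
  case (Suc k)
  show ?case
  proof (rule Ck_on_SucI[OF assms(1)])
    show "((\<lambda>x. f x powr a) has_derivative
        (\<lambda>h. (a * f x powr (a - 1)) * frechet_derivative f (at x) h)) (at x)" if "x \<in> U" for x
      using has_derivative_powr[OF Ck_on_SucD[OF Suc.prems that] has_derivative_const, of a]
        assms(2)[OF that]
      by (simp add: powr_diff mult_ac)
    show "Ck_on k U (\<lambda>x. (a * f x powr (a - 1)) * frechet_derivative f (at x) h)" for h
      by (intro Ck_on_bilinear[OF assms(1) bounded_bilinear_mult] Ck_on_const assms(1) Suc.IH)
        (use Suc.prems Suc.prems[THEN Ck_on_Suc_imp_Ck_on] in simp_all)
  qed
qed

lemma smooth_on_cong:
  "open U \<Longrightarrow> (\<And>x. x \<in> U \<Longrightarrow> f x = g x) \<Longrightarrow> smooth_on U f \<Longrightarrow> smooth_on U g"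
  unfolding smooth_on_def using Ck_on_cong by blast

lemma smooth_on_const: "open U \<Longrightarrow> smooth_on U (\<lambda>x. a)"
  by (simp add: smooth_on_def Ck_on_const)

lemma smooth_on_bounded_linear: "open U \<Longrightarrow> bounded_linear f \<Longrightarrow> smooth_on U f"
  by (simp add: smooth_on_def Ck_on_bounded_linear)

lemma smooth_on_compose_linear:
  "open U \<Longrightarrow> open W \<Longrightarrow> bounded_linear L \<Longrightarrow> L ` W \<subseteq> U \<Longrightarrow> smooth_on U f \<Longrightarrow>
    smooth_on W (\<lambda>x. f (L x))"
  by (simp add: smooth_on_def Ck_on_compose_linear)

lemma smooth_on_add:
  "open U \<Longrightarrow> smooth_on U f \<Longrightarrow> smooth_on U g \<Longrightarrow> smooth_on U (\<lambda>x. f x + g x)"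
  by (simp add: smooth_on_def Ck_on_add)

lemma smooth_on_scaleR:
  "open U \<Longrightarrow> smooth_on U f \<Longrightarrow> smooth_on U g \<Longrightarrow> smooth_on U (\<lambda>x. f x *\<^sub>R g x)"
  by (simp add: smooth_on_def Ck_on_bilinear[OF _ bounded_bilinear_scaleR])

lemma smooth_on_mult:
  fixes f g :: "'a::real_normed_vector \<Rightarrow> real"
  shows "open U \<Longrightarrow> smooth_on U f \<Longrightarrow> smooth_on U g \<Longrightarrow> smooth_on U (\<lambda>x. f x * g x)"
  using smooth_on_scaleR by fastforce

lemma smooth_on_uminus:
  fixes f :: "'a::real_normed_vector \<Rightarrow> real"
  shows "open U \<Longrightarrow> smooth_on U f \<Longrightarrow> smooth_on U (\<lambda>x. - f x)"
  using smooth_on_mult[OF _ smooth_on_const[of U "-1"], of f] by simp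

lemma smooth_on_diff:
  fixes f g :: "'a::real_normed_vector \<Rightarrow> real"
  shows "open U \<Longrightarrow> smooth_on U f \<Longrightarrow> smooth_on U g \<Longrightarrow> smooth_on U (\<lambda>x. f x - g x)"
  using smooth_on_add[OF _ _ smooth_on_uminus, of U f g] by simp

lemma smooth_on_power:
  fixes f :: "'a::real_normed_vector \<Rightarrow> real"
  shows "open U \<Longrightarrow> smooth_on U f \<Longrightarrow> smooth_on U (\<lambda>x. f x ^ n)"
  by (induction n) (simp_all add: smooth_on_const smooth_on_mult)

lemma smooth_on_powr:
  fixes f :: "'a::real_normed_vector \<Rightarrow> real"
  shows "open U \<Longrightarrow> smooth_on U f \<Longrightarrow> (\<And>x. x \<in> U \<Longrightarrow> f x > 0) \<Longrightarrow> smooth_on U (\<lambda>x. f x powr a)"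
  unfolding smooth_on_def by (blast intro: Ck_on_powr)

lemma smooth_on_divide:
  fixes f g :: "'a::real_normed_vector \<Rightarrow> real"
  assumes "open U" "smooth_on U f" "smooth_on U g" "\<And>x. x \<in> U \<Longrightarrow> g x > 0"
  shows "smooth_on U (\<lambda>x. f x / g x)"
proof (rule smooth_on_cong[OF assms(1)])
  show "smooth_on U (\<lambda>x. f x * g x powr - 1)"
    using assms by (intro smooth_on_mult smooth_on_powr)
qed (use assms(4) in \<open>simp add: powr_minus_divide less_imp_le\<close>)

lemma smooth_on_sqrt:
  assumes "open U" "smooth_on U f" "\<And>x. x \<in> U \<Longrightarrow> f x > 0"
  shows "smooth_on U (\<lambda>x. sqrt (f x))"
  by (rule smooth_on_cong[OF assms(1) _ smooth_on_powr[OF assms, of "1 / 2"]])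
    (use assms(3) in \<open>simp_all add: powr_half_sqrt less_imp_le\<close>)

lemma smooth_on_sum:
  assumes "open U" "\<And>i. i \<in> I \<Longrightarrow> smooth_on U (f i)"
  shows "smooth_on U (\<lambda>x. \<Sum>i\<in>I. f i x)"
  using assms by (induction I rule: infinite_finite_induct) (auto simp: smooth_on_const smooth_on_add)

lemma bounded_linear_axis: "bounded_linear (axis i :: 'b::euclidean_space \<Rightarrow> 'b^'n::finite)"
  unfolding linear_conv_bounded_linear[symmetric]
  by (rule linearI) (auto simp: vec_eq_iff axis_def)

lemma vec_eq_sum_axis: "x = (\<Sum>i\<in>UNIV. axis i (x $ i))"
  for x :: "'b::comm_monoid_add^'n::finite"
  by (simp add: vec_eq_iff axis_def)

lemma has_derivative_vecI:
  fixes f :: "'a::real_normed_vector \<Rightarrow> 'b::euclidean_space^'n::finite"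
  assumes "\<And>i. ((\<lambda>x. f x $ i) has_derivative (\<lambda>h. f' h $ i)) net"
  shows "(f has_derivative f') net"
proof -
  have "((\<lambda>x. \<Sum>i\<in>UNIV. axis i (f x $ i)) has_derivative
      (\<lambda>h. \<Sum>i\<in>UNIV. axis i (f' h $ i))) net"
    by (intro has_derivative_sum bounded_linear.has_derivative[OF bounded_linear_axis] assms)
  then show ?thesis
    by (simp flip: vec_eq_sum_axis)
qed

lemma smooth_on_vec:
  fixes f :: "'n::finite \<Rightarrow> 'a::real_normed_vector \<Rightarrow> 'b::euclidean_space"
  assumes "open U" "\<And>i. smooth_on U (f i)"
  shows "smooth_on U (\<lambda>x. \<chi> i. f i x)"
proof -
  have "(\<chi> i. f i x) = (\<Sum>i\<in>UNIV. axis i (f i x))" for x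
    using vec_eq_sum_axis[of "\<chi> i. f i x"] by simp
  moreover have "smooth_on U (\<lambda>x. axis i (f i x))" for i
    using assms Ck_on_linear_compose[OF \<open>open U\<close> bounded_linear_axis[of i], of _ "f i"] by (simp add: smooth_on_def)
  ultimately show ?thesis
    using smooth_on_sum[OF \<open>open U\<close>, of UNIV "\<lambda>i x. axis i (f i x)"] by simp
qed

lemma smooth_on_imp_has_derivative:
  assumes "smooth_on U f" "x \<in> U"
  shows "(f has_derivative frechet_derivative f (at x)) (at x)"
  using assms Ck_on_SucD unfolding smooth_on_def by blast

lemmas smooth_intros = smooth_on_const smooth_on_add smooth_on_diff smooth_on_mult smooth_on_uminus
  smooth_on_power smooth_on_divide smooth_on_sqrt smooth_on_vec

section \<open>Node values of a parsing\<close>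

lemma child_simps [simp]: "child T (i, 1) = lc T i" "child T (i, 2) = rc T i"
  by (simp_all add: child_def)

lemma edges_iff: "(a, b) \<in> edges T \<longleftrightarrow> (\<exists>c. a = Inl (fst c) \<and> b = child T c)"
  by (auto simp: edges_def)

lemma edges_child [simp]: "(Inl (fst c), child T c) \<in> edges T"
  unfolding edges_iff by blast

context
  fixes T :: "('i::finite, 'l::finite, 'o::finite) parsing"
  assumes T: "is_parsing T"
begin

lemma inj_child: "inj (child T)"
  and child_neq_root: "child T c \<noteq> root_node T"
  and bij_opt: "bij (opt T)"
proof -
  show "inj (child T)" "bij (opt T)"
    using T by (auto simp: is_parsing_def)
  show "child T c \<noteq> root_node T"
    using T unfolding is_parsing_def by (metis rangeI)
qed

lemma node_induct_down [case_names root child]: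
  assumes "P (root_node T)" "\<And>c. P (Inl (fst c)) \<Longrightarrow> P (child T c)"
  shows "P n"
proof -
  have "(root_node T, n) \<in> (edges T)\<^sup>*"
    using T by (simp add: is_parsing_def)
  then show ?thesis
    by induction (use assms in \<open>auto simp: edges_iff\<close>)
qed

lemma range_child: "range (child T) = - {root_node T}"
proof -
  have "n = root_node T \<or> n \<in> range (child T)" for n
    by (induction n rule: node_induct_down) auto
  then show ?thesis
    using child_neq_root by auto
qed

text \<open>A node is accessible once its only parent is. Since the tree is finite, recursion works in
  both directions, from the root to the leaves and from the leaves to the root.\<close>

lemma wf_edges: "wf (edges T)"
  unfolding wf_iff_acc
proof
  fix n
  show "n \<in> Wellfounded.acc (edges T)"
  proof (induction n rule: node_induct_down)
    case root
    show ?case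
      using child_neq_root by (intro accI[of "root_node T"]) (metis edges_iff)
  next
    case (child c)
    show ?case
    proof (rule accI)
      fix p assume "(p, child T c) \<in> edges T"
      then have "p = Inl (fst c)"
        using inj_child by (auto simp: edges_iff dest: injD)
      with child show "p \<in> Wellfounded.acc (edges T)"
        by simp
    qed
  qed
qed

lemma wf_edges_converse: "wf ((edges T)\<inverse>)"
  by (intro finite_acyclic_wf_converse wf_acyclic wf_edges finite)

lemma node_induct_up [case_names leaf internal]:
  assumes "\<And>l. P (Inr l)" "\<And>i. P (lc T i) \<Longrightarrow> P (rc T i) \<Longrightarrow> P (Inl i)"
  shows "P n"
  using wf_edges_converse
proof (induction n rule: wf_induct_rule)
  case (less n)
  show ?case
  proof (cases n)
    case (Inl i)
    then have "(lc T i, n) \<in> (edges T)\<inverse>" "(rc T i, n) \<in> (edges T)\<inverse>"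
      using edges_child[of "(i, 1)" T] edges_child[of "(i, 2)" T] by auto
    then show ?thesis
      using less assms(2) Inl by blast
  qed (use assms in auto)
qed

text \<open>The $2 n_i$ children are exactly the $n_i + n_o - 1$ nodes other than the root.\<close>

lemma card_internal: "CARD('i) = CARD('o) - 1"
proof -
  have "CARD('i \<times> 2) = card (range (child T))"
    using card_image[OF inj_child] by simp
  also have "\<dots> = CARD('i + 'l) - 1"
    unfolding range_child by (simp add: card_Diff_singleton Compl_eq_Diff_UNIV)
  finally have "CARD('i) * 2 = CARD('i) + CARD('l) - 1"
    by simp
  moreover have "CARD('l) = CARD('o)"
    by (rule bij_betw_same_card[OF bij_opt])
  moreover have "CARD('i) > 0"
    by simp
  ultimately show ?thesis
    by linarith
qed

lemma node_value_ex1: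
  fixes w :: "real^'o"
  shows "\<exists>!u. (\<forall>l. u (Inr l) = w $ opt T l) \<and> (\<forall>i. u (Inl i) = (u (lc T i) + u (rc T i)) / 2)"
proof -
  let ?val = "\<lambda>(u :: 'i + 'l \<Rightarrow> real) n. case n of Inl i \<Rightarrow> (u (lc T i) + u (rc T i)) / 2 | Inr l \<Rightarrow> w $ opt T l"
  have "\<exists>u. \<forall>n. u n = ?val u n"
  proof (rule dependent_wf_choice[OF wf_edges_converse])
    fix u u' :: "'i + 'l \<Rightarrow> real" and n and r :: real
    assume "\<And>z. (z, n) \<in> (edges T)\<inverse> \<Longrightarrow> u z = u' z"
    then have "u (lc T i) = u' (lc T i)" "u (rc T i) = u' (rc T i)" if "n = Inl i" for i
      using edges_child[of "(i, 1)" T] edges_child[of "(i, 2)" T] that by auto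
    then show "(r = ?val u n) = (r = ?val u' n)"
      by (cases n) auto
  qed auto
  then obtain u where u: "\<forall>n. u n = ?val u n" ..
  have leaf: "u (Inr l) = w $ opt T l" for l
    using u[rule_format, of "Inr l"] by simp
  have internal: "u (Inl i) = (u (lc T i) + u (rc T i)) / 2" for i
    using u[rule_format, of "Inl i"] by simp
  show ?thesis
  proof (rule ex1I[of _ u])
    show "(\<forall>l. u (Inr l) = w $ opt T l) \<and> (\<forall>i. u (Inl i) = (u (lc T i) + u (rc T i)) / 2)"
      using leaf internal by blast
    fix u' assume u': "(\<forall>l. u' (Inr l) = w $ opt T l) \<and> (\<forall>i. u' (Inl i) = (u' (lc T i) + u' (rc T i)) / 2)"
    have "u' n = u n" for n
      by (induction n rule: node_induct_up) (use leaf internal u' in metis)+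
    then show "u' = u" ..
  qed
qed

lemma node_value_leaf: "node_value T w (Inr l) = w $ opt T l"
  and node_value_internal:
    "node_value T w (Inl i) = (node_value T w (lc T i) + node_value T w (rc T i)) / 2"
  using theI'[OF node_value_ex1[of w]] by (auto simp: node_value_def)

lemma node_value_unique:
  assumes "\<And>l. u (Inr l) = w $ opt T l" "\<And>i. u (Inl i) = (u (lc T i) + u (rc T i)) / 2"
  shows "node_value T w = u"
  unfolding node_value_def by (rule the1_equality[OF node_value_ex1]) (use assms in auto)

lemma value_vec_uniform: "value_vec T (y *\<^sub>R 1) = y *\<^sub>R 1"
proof -
  have "node_value T (y *\<^sub>R 1) = (\<lambda>_. y)"
    by (rule node_value_unique) auto
  then show ?thesis
    by (simp add: value_vec_def vec_eq_iff)
qed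

lemma node_value_pos:
  assumes "\<forall>j. w $ j > 0"
  shows "node_value T w n > 0"
  by (induction n rule: node_induct_up) (use assms in \<open>auto simp: node_value_leaf node_value_internal\<close>)

end

section \<open>Node values from unfolding parameters\<close>

text \<open>The value of the child addressed by \<open>c\<close> divided by that of its parent: if the children of
  \<open>i\<close> have mean $u$ and unfolding parameter $\alpha_i$, their values are
  $u\,(1 \pm \alpha_i / 2)$.\<close>

definition child_factor :: "real^'i \<Rightarrow> 'i \<times> 2 \<Rightarrow> real" where
  "child_factor \<alpha> c = (if snd c = 1 then 1 + \<alpha> $ fst c / 2 else 1 - \<alpha> $ fst c / 2)"

text \<open>The value of a node divided by that of the root, as a function of the unfolding parameters:
  the product of the factors along the path from the root. It is chosen as a solution of the
  recursion from the root to the leaves.\<close>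

definition node_ratio :: "('i, 'l, 'o) parsing \<Rightarrow> real^'i \<Rightarrow> 'i + 'l \<Rightarrow> real" where
  "node_ratio T \<alpha> = (SOME d. d (root_node T) = 1 \<and>
     (\<forall>c. d (child T c) = d (Inl (fst c)) * child_factor \<alpha> c))"

context
  fixes T :: "('i::finite, 'l::finite, 'o::finite) parsing"
  assumes T: "is_parsing T"
begin

lemma node_ratio_root: "node_ratio T \<alpha> (root_node T) = 1"
  and node_ratio_child:
    "node_ratio T \<alpha> (child T c) = node_ratio T \<alpha> (Inl (fst c)) * child_factor \<alpha> c"
proof -
  let ?val = "\<lambda>d n. if n = root_node T then 1
    else d (Inl (fst (inv (child T) n))) * child_factor \<alpha> (inv (child T) n)"
  have "\<exists>d :: 'i + 'l \<Rightarrow> real. \<forall>n. d n = ?val d n"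
  proof (rule dependent_wf_choice[OF wf_edges[OF T]])
    fix d d' :: "'i + 'l \<Rightarrow> real" and n and r :: real
    assume eq: "\<And>z. (z, n) \<in> edges T \<Longrightarrow> d z = d' z"
    have "d (Inl (fst (inv (child T) n))) = d' (Inl (fst (inv (child T) n)))" if "n \<noteq> root_node T"
    proof (rule eq)
      have "child T (inv (child T) n) = n"
        using that range_child[OF T] by (simp add: f_inv_into_f)
      then show "(Inl (fst (inv (child T) n)), n) \<in> edges T"
        by (metis edges_child)
    qed
    then show "(r = ?val d n) = (r = ?val d' n)"
      by auto
  qed auto
  then obtain d where d: "\<forall>n. d n = ?val d n" ..
  have "d (root_node T) = 1 \<and> (\<forall>c. d (child T c) = d (Inl (fst c)) * child_factor \<alpha> c)"
    using d[rule_format, of "root_node T"] d[rule_format, of "child T c" for c]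
      child_neq_root[OF T] inv_f_f[OF inj_child[OF T]] by simp
  then have "node_ratio T \<alpha> (root_node T) = 1 \<and> (\<forall>c. node_ratio T \<alpha> (child T c) =
      node_ratio T \<alpha> (Inl (fst c)) * child_factor \<alpha> c)"
    unfolding node_ratio_def by (rule someI[where P = "\<lambda>d. d (root_node T) = 1 \<and>
      (\<forall>c. d (child T c) = d (Inl (fst c)) * child_factor \<alpha> c)"])
  then show "node_ratio T \<alpha> (root_node T) = 1"
    "node_ratio T \<alpha> (child T c) = node_ratio T \<alpha> (Inl (fst c)) * child_factor \<alpha> c"
    by blast+
qed

lemma node_ratio_children:
  "node_ratio T \<alpha> (lc T i) = node_ratio T \<alpha> (Inl i) * (1 + \<alpha> $ i / 2)"
  "node_ratio T \<alpha> (rc T i) = node_ratio T \<alpha> (Inl i) * (1 - \<alpha> $ i / 2)"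
  using node_ratio_child[of \<alpha> "(i, 1)"] node_ratio_child[of \<alpha> "(i, 2)"]
  by (simp_all add: child_factor_def)

lemma node_ratio_zero: "node_ratio T 0 n = 1"
  by (induction n rule: node_induct_down[OF T, case_names root child])
    (simp_all add: node_ratio_root node_ratio_child child_factor_def)

lemma node_ratio_pos:
  assumes "\<forall>i. \<bar>\<alpha> $ i\<bar> < 2"
  shows "node_ratio T \<alpha> n > 0"
proof (induction n rule: node_induct_down[OF T, case_names root child])
  case (child c)
  have "child_factor \<alpha> c > 0"
    using assms[rule_format, of "fst c"] by (auto simp: child_factor_def)
  with child show ?case
    by (simp add: node_ratio_child)
qed (simp add: node_ratio_root)

text \<open>Each ratio is a polynomial in the unfolding parameters.\<close>

lemma smooth_on_node_ratio:
  fixes L :: "'a::real_normed_vector \<Rightarrow> real^'i"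
  assumes "open U" "bounded_linear L"
  shows "smooth_on U (\<lambda>p. node_ratio T (L p) n)"
proof (induction n rule: node_induct_down[OF T, case_names root child])
  case root
  show ?case using assms by (simp add: node_ratio_root smooth_on_const)
next
  case (child c)
  have "smooth_on U (\<lambda>p. L p $ fst c)"
    using assms by (intro smooth_on_bounded_linear bounded_linear_compose[OF bounded_linear_vec_nth])
  then have "smooth_on U (\<lambda>p. child_factor (L p) c)"
    using assms(1) unfolding child_factor_def by (cases "snd c = 1") (simp_all add: smooth_intros)
  with child assms(1) show ?case
    by (simp add: node_ratio_child smooth_on_mult)
qed

text \<open>Dividing the value of every node by the value of the root turns the values into ratios
  that depend on the unfolding parameters only.\<close>

lemma node_value_eq_ratio:
  assumes "\<forall>j. w $ j > 0"
  shows "node_value T w n = node_value T w (root_node T) * node_ratio T (alpha T w) n"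
proof (induction n rule: node_induct_down[OF T, case_names root child])
  case (child c)
  have pos: "node_value T w n > 0" for n
    by (rule node_value_pos[OF T assms])
  have "node_value T w (child T c) = node_value T w (Inl (fst c)) * child_factor (alpha T w) c"
  proof -
    have "p = (p + q) / 2 * (1 + 2 * (p - q) / (p + q) / 2)"
      "q = (p + q) / 2 * (1 - 2 * (p - q) / (p + q) / 2)" if "p > 0" "q > 0" for p q :: real
      using that by (auto simp: divide_simps add_pos_pos)
    from this[where p = "node_value T w (lc T (fst c))" and q = "node_value T w (rc T (fst c))",
        OF pos pos] show ?thesis
      using exhaust_2[of "snd c"]
      by (auto simp: child_factor_def child_def alpha_def value_vec_def node_value_internal[OF T])
  qed
  with child show ?case
    by (simp add: node_ratio_child)
qed (simp add: node_ratio_root)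

lemma abs_alpha_less_2:
  assumes "\<forall>j. w $ j > 0"
  shows "\<bar>alpha T w $ i\<bar> < 2"
  using node_value_pos[OF T assms, of "lc T i"] node_value_pos[OF T assms, of "rc T i"]
  by (simp add: alpha_def value_vec_def abs_less_iff field_simps)

text \<open>The option values for which the root has value \<open>y\<close> and the unfolding parameters are \<open>\<alpha>\<close>.\<close>

definition option_values :: "real \<Rightarrow> real^'i \<Rightarrow> real^'o" where
  "option_values y \<alpha> = (\<chi> j. y * node_ratio T \<alpha> (Inr (inv (opt T) j)))"

lemma node_value_option_values: "node_value T (option_values y \<alpha>) n = y * node_ratio T \<alpha> n"
proof -
  have "node_value T (option_values y \<alpha>) = (\<lambda>n. y * node_ratio T \<alpha> n)"
    by (rule node_value_unique[OF T])
      (auto simp: option_values_def inv_f_f bij_is_inj[OF bij_opt[OF T]] node_ratio_children field_simps)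
  then show ?thesis by simp
qed

text \<open>The $n_o$ positive option values are thus reparametrized by the value of the root and the
  $n_o - 1$ unfolding parameters.\<close>

lemma bij_betw_root_alpha:
  "bij_betw (\<lambda>w. (node_value T w (root_node T), alpha T w))
     {w. \<forall>j. w $ j > 0} ({0<..} \<times> {\<alpha>. \<forall>i. \<bar>\<alpha> $ i\<bar> < 2})"
proof (rule bij_betw_byWitness[where f' = "\<lambda>(y, \<alpha>). option_values y \<alpha>"])
  show "\<forall>w\<in>{w. \<forall>j. w $ j > 0}. (\<lambda>(y, \<alpha>). option_values y \<alpha>)
      (node_value T w (root_node T), alpha T w) = w"
    using bij_is_surj[OF bij_opt[OF T]]
    by (auto simp: option_values_def vec_eq_iff node_value_eq_ratio[symmetric] node_value_leaf[OF T]
        surj_f_inv_f)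
  have "alpha T (option_values y \<alpha>) = \<alpha>" if "y > 0" "\<forall>i. \<bar>\<alpha> $ i\<bar> < 2" for y \<alpha>
  proof -
    have "2 * (y * (r * (1 + a / 2)) - y * (r * (1 - a / 2))) /
        (y * (r * (1 + a / 2)) + y * (r * (1 - a / 2))) = a" if "r > 0" for r a
    proof -
      have "y * (r * (1 + a / 2)) + y * (r * (1 - a / 2)) = 2 * (y * r)"
        "y * (r * (1 + a / 2)) - y * (r * (1 - a / 2)) = a * (y * r)"
        by (simp_all add: algebra_simps)
      then show ?thesis
        using that \<open>y > 0\<close> by simp
    qed
    from this[OF node_ratio_pos[OF that(2)]] show ?thesis
      by (simp add: alpha_def value_vec_def vec_eq_iff node_value_option_values node_ratio_children)
  qed
  then show "\<forall>p\<in>{0<..} \<times> {\<alpha>. \<forall>i. \<bar>\<alpha> $ i\<bar> < 2}. (\<lambda>w. (node_value T w (root_node T), alpha T w))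
      ((\<lambda>(y, \<alpha>). option_values y \<alpha>) p) = p"
    by (auto simp: node_value_option_values node_ratio_root)
  show "(\<lambda>w. (node_value T w (root_node T), alpha T w)) ` {w. \<forall>j. w $ j > 0} \<subseteq>
      {0<..} \<times> {\<alpha>. \<forall>i. \<bar>\<alpha> $ i\<bar> < 2}"
    by (auto simp: node_value_pos[OF T] abs_alpha_less_2)
  show "(\<lambda>(y, \<alpha>). option_values y \<alpha>) ` ({0<..} \<times> {\<alpha>. \<forall>i. \<bar>\<alpha> $ i\<bar> < 2}) \<subseteq>
      {w. \<forall>j. w $ j > 0}"
    by (auto simp: option_values_def node_ratio_pos)
qed

end

section \<open>Symmetry of the tree dynamics\<close>

text \<open>With equal child values the block field is symmetric under exchanging the children.\<close>

lemma seeley_uniform: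
  "seeley \<sigma> m (y *\<^sub>R 1) $ k =
     y * (1 - m $ 1 - m $ 2) - m $ k / y + y * m $ k * (1 - m $ 1 - m $ 2) - \<sigma> * (m $ 1 * m $ 2)"
  using exhaust_2[of k] by (auto simp: seeley_def Let_def algebra_simps)

lemma tree_field_uniform:
  "tree_field \<sigma> m (y *\<^sub>R 1) $ (i, k) =
     y * (1 - m $ (i, 1) - m $ (i, 2)) - m $ (i, k) / y
     + y * m $ (i, k) * (1 - m $ (i, 1) - m $ (i, 2)) - \<sigma> * (m $ (i, 1) * m $ (i, 2))"
proof -
  have "block i (y *\<^sub>R 1) = y *\<^sub>R 1"
    by (simp add: block_def vec_eq_iff)
  then show ?thesis
    by (simp add: tree_field_def seeley_uniform) (simp add: block_def)
qed

lemma tree_equivariant_uniform: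
  fixes T :: "('i::finite, 'l::finite, 'o::finite) parsing"
  assumes T: "is_parsing T"
  shows "tree_equivariant T (\<lambda>m l. tree_field (\<sigma> l) m (y l *\<^sub>R 1))"
  unfolding tree_equivariant_def
proof (intro ballI allI)
  fix \<gamma> and x :: "real^('i \<times> 2)" and l
  assume \<gamma>: "\<gamma> \<in> tree_isos T"
  (* The coordinate of the image at c is the coordinate of x at \<pi> c. As tree isomorphisms preserve
     parents, \<pi> maps the pair of coordinates of a block to the pair of some block. *)
  define \<pi> where "\<pi> c = inv (child T) (inv \<gamma> (child T c))" for c
  have bij: "bij \<gamma>" and edge: "(a, b) \<in> edges T \<longleftrightarrow> (\<gamma> a, \<gamma> b) \<in> edges T" for a b
    using \<gamma> by (auto simp: tree_isos_def)
  have child_\<pi>: "child T (\<pi> c) = inv \<gamma> (child T c)" and parent_\<pi>: "Inl (fst (\<pi> c)) = inv \<gamma> (Inl (fst c))" for c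
  proof -
    have "(inv \<gamma> (Inl (fst c)), inv \<gamma> (child T c)) \<in> edges T"
      using edge edges_child[of c T] by (metis bij bij_inv_eq_iff)
    then obtain c' where c': "inv \<gamma> (Inl (fst c)) = Inl (fst c')" "inv \<gamma> (child T c) = child T c'"
      by (auto simp: edges_iff)
    then have "\<pi> c = c'"
      using inj_child[OF T] by (simp add: \<pi>_def)
    with c' show "child T (\<pi> c) = inv \<gamma> (child T c)" "Inl (fst (\<pi> c)) = inv \<gamma> (Inl (fst c))"
      by simp_all
  qed
  have inj: "inj \<pi>"
    using child_\<pi> inj_child[OF T] bij by (metis bij_inv_eq_iff injD injI)
  have act: "act T \<gamma> z $ c = z $ \<pi> c" for z c
    by (simp add: act_def \<pi>_def)
  have "tree_field (\<sigma> l) (act T \<gamma> x) (y l *\<^sub>R 1) $ (i, k) =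
      act T \<gamma> (tree_field (\<sigma> l) x (y l *\<^sub>R 1)) $ (i, k)" for i k
  proof -
    obtain j where "fst (\<pi> (i, 1)) = j" "fst (\<pi> (i, 2)) = j" "fst (\<pi> (i, k)) = j"
      using parent_\<pi>[of "(i, _)"] by (metis fst_conv sum.inject(1))
    then obtain k1 k2 k' where \<pi>: "\<pi> (i, 1) = (j, k1)" "\<pi> (i, 2) = (j, k2)" "\<pi> (i, k) = (j, k')"
      by (metis prod.collapse)
    moreover have "k1 \<noteq> k2"
      using injD[OF inj, of "(i, 1)" "(i, 2)"] \<pi> by auto
    ultimately show ?thesis
      using exhaust_2[of k1] exhaust_2[of k2]
      by (auto simp: act tree_field_uniform algebra_simps)
  qed
  then show "tree_field (\<sigma> l) (act T \<gamma> x) (y l *\<^sub>R 1) = act T \<gamma> (tree_field (\<sigma> l) x (y l *\<^sub>R 1))"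
    by (simp add: vec_eq_iff)
qed

section \<open>The equilibrium and its singularity\<close>

text \<open>On the diagonal $m_1 = m_2 = b$ an equilibrium solves
  $(2v + \sigma) b^2 + (v + 1/v) b = v$, and \<open>mbar\<close> is the positive root.\<close>

lemma mbar_properties:
  assumes "v > 0" "\<sigma> > 0"
  shows "(2 * v + \<sigma>) * (mbar v \<sigma>)\<^sup>2 + (v + 1 / v) * mbar v \<sigma> = v"
    and "2 * (2 * v + \<sigma>) * mbar v \<sigma> + (v + 1 / v) = sqrt ((v + 1 / v)\<^sup>2 + 4 * (2 * v + \<sigma>) * v)"
    and "0 < mbar v \<sigma>" "mbar v \<sigma> < 1 / 2"
proof -
  define c w r where "c = 2 * v + \<sigma>" and "w = v + 1 / v" and "r = sqrt (w\<^sup>2 + 4 * c * v)"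
  have pos: "c > 0" "w > 0" "w\<^sup>2 + 4 * c * v > 0"
  proof -
    show "c > 0" "w > 0"
      using assms by (simp_all add: c_def w_def add_pos_pos)
    then show "w\<^sup>2 + 4 * c * v > 0"
      using assms by (intro add_pos_pos) simp_all
  qed
  have "1 + 2 * v^2 + 4 * \<sigma> * v^3 + 9 * v^4 = v\<^sup>2 * (w\<^sup>2 + 4 * c * v)"
    using assms by (simp add: c_def w_def power2_eq_square power3_eq_cube power4_eq_xxxx field_simps)
  then have "sqrt (1 + 2 * v^2 + 4 * \<sigma> * v^3 + 9 * v^4) = v * r"
    using assms by (simp add: r_def real_sqrt_mult)
  moreover have "1 + v\<^sup>2 = v * w"
    using assms by (simp add: w_def field_simps power2_eq_square)
  ultimately have "mbar v \<sigma> = (v * (r - w)) / (v * (2 * c))"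
    unfolding mbar_def by (simp add: c_def algebra_simps)
  then have m: "mbar v \<sigma> = (r - w) / (2 * c)"
    using assms by simp
  then show "2 * (2 * v + \<sigma>) * mbar v \<sigma> + (v + 1 / v) = sqrt ((v + 1 / v)\<^sup>2 + 4 * (2 * v + \<sigma>) * v)"
    using pos by (simp add: c_def[symmetric] w_def[symmetric] r_def[symmetric])
  have "2 * c * mbar v \<sigma> + w = r"
    using m pos by simp
  moreover have "r\<^sup>2 = w\<^sup>2 + 4 * c * v"
    unfolding r_def using pos by simp
  ultimately have "(2 * c * mbar v \<sigma> + w)\<^sup>2 = w\<^sup>2 + 4 * c * v"
    by simp
  then have "4 * c * (c * (mbar v \<sigma>)\<^sup>2 + w * mbar v \<sigma> - v) = 0"
    by (simp add: power2_eq_square algebra_simps)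
  then have eq: "c * (mbar v \<sigma>)\<^sup>2 + w * mbar v \<sigma> = v"
    using pos by simp
  then show "(2 * v + \<sigma>) * (mbar v \<sigma>)\<^sup>2 + (v + 1 / v) * mbar v \<sigma> = v"
    by (simp add: c_def w_def)
  have "r > w"
    unfolding r_def using pos assms by (intro real_less_rsqrt) auto
  then show "0 < mbar v \<sigma>"
    using m pos by simp
  show "mbar v \<sigma> < 1 / 2"
  proof (rule ccontr)
    assume "\<not> mbar v \<sigma> < 1 / 2"
    then have "c * (1 / 2)\<^sup>2 + w * (1 / 2) \<le> c * (mbar v \<sigma>)\<^sup>2 + w * mbar v \<sigma>"
      using pos by (intro add_mono mult_left_mono power_mono) auto
    moreover have "c * (1 / 2)\<^sup>2 + w * (1 / 2) = v + \<sigma> / 4 + 1 / v / 2"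
      by (simp add: c_def w_def power2_eq_square field_simps)
    moreover have "1 / v / 2 > 0"
      using assms by simp
    ultimately show False
      using assms(2) unfolding eq by linarith
  qed
qed

lemma mbar_in_state_space:
  assumes "v > 0" "\<sigma> > 0"
  shows "mbar v \<sigma> *\<^sub>R 1 \<in> state_space"
  using mbar_properties[OF assms] by (simp add: state_space_def)

lemma tree_field_mbar:
  assumes "v > 0" "\<sigma> > 0"
  shows "tree_field \<sigma> (mbar v \<sigma> *\<^sub>R 1) (v *\<^sub>R 1) = 0"
  using mbar_properties(1)[OF assms]
  by (auto simp: vec_eq_iff tree_field_uniform algebra_simps power2_eq_square)

text \<open>The critical value of \<open>\<sigma>\<close> is the one for which the equilibrium satisfies
  $v (1 - 2 \bar m) = 1/v$, the condition that the linearization vanishes in the direction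
  $m_1 - m_2$.\<close>

lemma mbar_critical:
  assumes "v > 1" "\<sigma> = 4 * v^3 / (v^2 - 1)^2"
  shows "mbar v \<sigma> = (v\<^sup>2 - 1) / (2 * v\<^sup>2)"
proof -
  have v: "v > 0" "v\<^sup>2 > 1" 
    using assms one_less_power[of v 2] by auto
  have \<sigma>: "\<sigma> > 0"
    using assms(2) v by simp
  define b where "b = (v\<^sup>2 - 1) / (2 * v\<^sup>2)"
  have b: "b > 0"
    using v by (simp add: b_def)
  have "\<sigma> * b\<^sup>2 = 1 / v"
    using v by (simp add: b_def assms(2) power_divide power_mult_distrib power2_eq_square[of "2 * v ^ 2"])
      (simp add: power2_eq_square power3_eq_cube power4_eq_xxxx field_simps)
  moreover have "2 * v * b\<^sup>2 + (v + 1 / v) * b = v - 1 / v"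
    using v by (simp add: b_def eval_nat_numeral field_simps)
  ultimately have eq: "(2 * v + \<sigma>) * b\<^sup>2 + (v + 1 / v) * b = v"
    by (simp add: algebra_simps)
  define m where "m = mbar v \<sigma>"
  have "((2 * v + \<sigma>) * (m + b) + (v + 1 / v)) * (m - b) = 0"
    using eq mbar_properties(1)[OF v(1) \<sigma>] by (simp add: m_def algebra_simps power2_eq_square)
  moreover have "(2 * v + \<sigma>) * (m + b) + (v + 1 / v) > 0"
    using mbar_properties(3)[OF v(1) \<sigma>] v(1) \<sigma> b by (intro add_pos_pos mult_pos_pos) (auto simp: m_def)
  ultimately have "m = b" by simp
  then show ?thesis by (simp add: m_def b_def)
qed

text \<open>The vector with entries $1, -1$ in every block lies in the kernel of the Jacobian.\<close>

lemma singularity_mbar: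
  fixes v \<sigma> :: real
  assumes "v > 1" "\<sigma> = 4 * v^3 / (v^2 - 1)^2"
  shows "singularity (\<lambda>m :: real^('i::finite \<times> 2). tree_field \<sigma> m (v *\<^sub>R 1)) (mbar v \<sigma> *\<^sub>R 1)"
proof -
  have v: "v > 0" "v\<^sup>2 > 1" 
    using assms one_less_power[of v 2] by auto
  have \<sigma>: "\<sigma> > 0"
    using assms(2) v by simp
  define b where "b = mbar v \<sigma>"
  define F where "F = (\<lambda>m :: real^('i \<times> 2). tree_field \<sigma> m (v *\<^sub>R 1))"
  define D where "D = (\<lambda>h :: real^('i \<times> 2). \<chi> c. let i = fst c; k = snd c in
     - v * (h $ (i, 1) + h $ (i, 2)) - h $ (i, k) / v
     + v * h $ (i, k) * (1 - 2 * b) - v * b * (h $ (i, 1) + h $ (i, 2))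
     - \<sigma> * b * (h $ (i, 1) + h $ (i, 2)))"
  have D: "(F has_derivative D) (at (b *\<^sub>R 1))"
  proof -
    have "((\<lambda>m. F m $ c) has_derivative (\<lambda>h. D h $ c)) (at (b *\<^sub>R 1))" for c
    proof -
      obtain i k where c: "c = (i, k)" by (cases c)
      show ?thesis
        unfolding F_def c tree_field_uniform D_def
        by (auto intro!: derivative_eq_intros bounded_linear_imp_has_derivative
            bounded_linear_vec_nth simp: divide_inverse fun_eq_iff Let_def algebra_simps)
    qed
    then show ?thesis by (rule has_derivative_vecI)
  qed
  define h :: "real^('i \<times> 2)" where "h = (\<chi> c. if snd c = 1 then 1 else -1)"
  have "1 / v = v * (1 - 2 * b)"
    using v by (simp add: b_def mbar_critical[OF assms] field_simps power2_eq_square)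
  then have "D h = 0"
    by (auto simp: D_def h_def vec_eq_iff)
  moreover have "h \<noteq> 0"
    by (auto simp: h_def vec_eq_iff)
  moreover have "jacobian F (at (b *\<^sub>R 1)) *v h = D h"
    using D frechet_derivative_at[OF D] by (simp add: jacobian_def matrix_works has_derivative_linear)
  ultimately have "\<not> invertible (jacobian F (at (b *\<^sub>R 1)))"
    by (metis matrix_left_invertible_ker invertible_left_inverse)
  then have "det (jacobian F (at (b *\<^sub>R 1))) = 0"
    by (simp add: invertible_det_nz)
  then show ?thesis
    unfolding singularity_def F_def[symmetric] b_def[symmetric]
    using D tree_field_mbar[OF v(1) \<sigma>] by (auto simp: differentiable_def F_def b_def)
qed

section \<open>The pitchfork in a single block\<close>

text \<open>The matrices that commute with the swap are those with equal diagonal entries \<open>p\<close> and equal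
  off-diagonal entries \<open>q\<close>; their eigenvalues are $p + q$ on the diagonal direction and $p - q$
  on the antidiagonal one.\<close>

definition sym2 :: "real \<Rightarrow> real \<Rightarrow> real^2^2" where
  "sym2 p q = (\<chi> i j. if i = j then p else q)"

text \<open>With positive eigenvalues, the segment to the identity stays within the invertible matrices
  that commute with the swap.\<close>

lemma sym2_in_equivariant_GL0:
  assumes "p + q > 0" "p - q > 0"
  shows "sym2 p q \<in> equivariant_GL0 S2"
proof -
  let ?X = "{M :: real^2^2. invertible M \<and> (\<forall>\<gamma>\<in>S2. M ** \<gamma> = \<gamma> ** M)}"
  have in_X: "sym2 p q \<in> ?X" if "p + q > 0" "p - q > 0" for p q
  proof -
    have "(p + q) * (p - q) > 0"
      using that by simp
    then have "det (sym2 p q) \<noteq> 0"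
      by (simp add: det_2 sym2_def algebra_simps)
    moreover have "sym2 p q ** \<gamma> = \<gamma> ** sym2 p q" if "\<gamma> \<in> S2" for \<gamma>
      using that
      by (auto simp: S2_def sym2_def vec_eq_iff[where 'a = "real^2"] vec_eq_iff[where 'a = real]
          forall_2 matrix_matrix_mult_def UNIV_2 mat_def)
    ultimately show ?thesis
      by (simp add: invertible_det_nz)
  qed
  have "closed_segment (mat 1) (sym2 p q) \<subseteq> ?X"
  proof
    fix M assume "M \<in> closed_segment (mat 1) (sym2 p q)"
    then obtain u where u: "0 \<le> u" "u \<le> 1" "M = (1 - u) *\<^sub>R mat 1 + u *\<^sub>R sym2 p q"
      by (auto simp: in_segment)
    then have "M = sym2 (1 - u + u * p) (u * q)"
      by (simp add: vec_eq_iff sym2_def mat_def)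
    moreover have "(1 - u) + u * z > 0" if "z > 0" for z :: real
      using u(1,2) that by (cases "u = 0") (auto intro: add_nonneg_pos)
    from this[OF assms(1)] this[OF assms(2)]
    have "(1 - u + u * p) + u * q > 0" "(1 - u + u * p) - u * q > 0"
      by (simp_all add: algebra_simps)
    ultimately show "M \<in> ?X"
      using in_X by blast
  qed
  then show ?thesis
    unfolding equivariant_GL0_def mem_Collect_eq connected_component_def
    by (intro exI[of _ "closed_segment (mat 1) (sym2 p q)"]) auto
qed

text \<open>In the coordinates $a = (m_1 - m_2)/2$ and $b = (m_1 + m_2)/2$ the block field is
  $\dot a = a\,(v(1 - 2b) - 1/v)$, $\dot b = -(c b^2 + w b - v - s a^2)$ with $c = 2v + s$ and
  $w = v + 1/v$. For fixed $a$ the positive zero of $\dot b$ is $(r - w)/(2c)$; for $a = 0$ it is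
  $m = (r_0 - w)/(2c)$. The growth rate of $a$ therefore splits into its value at $a = 0$ on the
  zero set of $\dot b$, a negative multiple of $a^2$, and a multiple of $\dot b$.\<close>

lemma pitchfork_factorization:
  fixes a b c m r r0 s v w :: real
  assumes "v > 0" "s > 0" "b > 0" "c = 2 * v + s" "w = v + 1 / v"
    and r: "r > 0" "r\<^sup>2 = w\<^sup>2 + 4 * c * (v + s * a\<^sup>2)"
    and r0: "r0 > 0" "r0\<^sup>2 = w\<^sup>2 + 4 * c * v" "2 * c * m + w = r0"
  shows "(v * (1 - 2 * m) - 1 / v) - a\<^sup>2 * (4 * v * s / (r + r0))
      - 4 * v / (w + 2 * c * b + r) * (c * b\<^sup>2 + w * b - v - s * a\<^sup>2) = v * (1 - 2 * b) - 1 / v"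
proof -
  have pos: "c > 0" "w > 0" "w + 2 * c * b + r > 0" "r + r0 > 0"
  proof -
    show "c > 0" "w > 0"
      using assms by (simp_all add: add_pos_pos)
    then show "w + 2 * c * b + r > 0" "r + r0 > 0"
      using assms(3) r(1) r0(1) by (simp_all add: add_pos_pos)
  qed
  have cancel: "4 * v / d * y = v * x / c" if "x * d = 4 * c * y" "d > 0" for x d y
  proof -
    have "y = x * d / (4 * c)"
      using that pos(1) by simp
    then show ?thesis
      using that(2) by simp
  qed
  have "(2 * c * b + w - r) * (w + 2 * c * b + r) = 4 * c * (c * b\<^sup>2 + w * b - v - s * a\<^sup>2)"
    using r(2) by (simp add: power2_eq_square algebra_simps)
  then have 1: "4 * v / (w + 2 * c * b + r) * (c * b\<^sup>2 + w * b - v - s * a\<^sup>2) =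
      v * (2 * c * b + w - r) / c"
    using pos(3) by (rule cancel)
  have "(r - r0) * (r + r0) = 4 * c * s * a\<^sup>2"
    using r(2) r0(2) by (simp add: power2_eq_square algebra_simps)
  then have 2: "a\<^sup>2 * (4 * v * s / (r + r0)) = v * (r - r0) / c"
    using cancel[of "r - r0" "r + r0" "s * a\<^sup>2"] pos by (simp add: mult_ac)
  have 3: "2 * m = (r0 - w) / c"
    using pos r0(3) by (simp add: field_simps)
  show ?thesis
    unfolding 1 2 using pos
    by (simp add: 3 right_diff_distrib) (simp add: field_simps)
qed

text \<open>At the critical $\sigma$ and up to a positive factor, the expression below is the
  derivative in \<open>v\<close> of the growth rate $v(1 - 2 \bar m) - 1/v$ of $m_1 - m_2$ at the equilibrium.\<close>

lemma pitchfork_speed: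
  fixes v \<sigma> :: real
  assumes "v > 1" "\<sigma> = 4 * v^3 / (v^2 - 1)^2"
  defines "m \<equiv> mbar v \<sigma>"
  defines "e \<equiv> 2 * (2 * v + \<sigma>) * m + (v + 1 / v)"
  shows "e * (1 - 2 * m + 1 / v\<^sup>2) - 2 * v * (1 - (1 - 1 / v\<^sup>2) * m - 2 * m\<^sup>2) > 0"
proof -
  have v: "v > 0" "v\<^sup>2 > 1"
    using assms one_less_power[of v 2] by auto
  have m: "m = (v\<^sup>2 - 1) / (2 * v\<^sup>2)"
    unfolding m_def by (rule mbar_critical[OF assms(1,2)])
  have m2: "2 * m = 1 - 1 / v\<^sup>2"
    using v by (simp add: m diff_divide_distrib)
  have "\<sigma> * m > 0"
    using v by (simp add: assms(2) m)
  then have "e > 2 * v * (2 * m) + (v + 1 / v)"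
    by (simp add: e_def algebra_simps)
  also have "2 * v * (2 * m) + (v + 1 / v) = v * (2 - 1 / v\<^sup>2) + v"
    using v unfolding m2 by (simp add: field_simps power2_eq_square)
  finally have "e - v * (2 - 1 / v\<^sup>2) > 0"
    using v(1) by linarith
  moreover have "e * (1 - 2 * m + 1 / v\<^sup>2) - 2 * v * (1 - (1 - 1 / v\<^sup>2) * m - 2 * m\<^sup>2)
      = 2 / v\<^sup>2 * (e - v * (2 - 1 / v\<^sup>2))"
  proof -
    have "(1 - 1 / v\<^sup>2) * m + 2 * m\<^sup>2 = (1 - 1 / v\<^sup>2)\<^sup>2"
      unfolding m2[symmetric] by (simp add: power2_eq_square)
    then have "1 - (1 - 1 / v\<^sup>2) * m - 2 * m\<^sup>2 = 1 / v\<^sup>2 * (2 - 1 / v\<^sup>2)"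
      by (simp add: power2_eq_square algebra_simps)
    moreover have "1 - 2 * m + 1 / v\<^sup>2 = 2 / v\<^sup>2"
      unfolding m2 by simp
    ultimately show ?thesis
      by (simp only:) (simp add: algebra_simps add_divide_distrib diff_divide_distrib)
  qed
  ultimately show ?thesis
    using v(1) by simp
qed

text \<open>The bifurcation parameter enters through increasing functions \<open>V\<close> and \<open>\<Sigma>\<close>, one of which is
  constant in either application: this treats the parameters $\sigma$ and $v$ at once.\<close>

lemma S2_pitchfork_seeley:
  fixes V \<Sigma> :: "real \<Rightarrow> real"
  assumes V: "smooth_on {0<..} V" "\<And>l. l > 0 \<Longrightarrow> V l > 0"
    and \<Sigma>: "smooth_on {0<..} \<Sigma>" "\<And>l. l > 0 \<Longrightarrow> \<Sigma> l > 0"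
    and l0: "l0 > 0" "V l0 = v" "\<Sigma> l0 = \<sigma>"
    and crit: "v > 1" "\<sigma> = 4 * v^3 / (v^2 - 1)^2"
    and V': "(V has_real_derivative V') (at l0)" "V' \<ge> 0"
    and \<Sigma>': "(\<Sigma> has_real_derivative \<Sigma>') (at l0)" "\<Sigma>' \<ge> 0"
    and increasing: "V' + \<Sigma>' > 0"
  shows "S2_pitchfork (\<lambda>m l. seeley (\<Sigma> l) m (V l *\<^sub>R 1)) (mbar v \<sigma> *\<^sub>R 1) l0"
proof -
  have v: "v > 0" "\<sigma> > 0"
    using V(2) \<Sigma>(2) l0 by auto
  (* The notation is that of the factorization above: a and b are the coordinates, r and r0 the
     two square roots. The change of coordinates maps a to a * q and b to the negative of the
     b-component of the field; in these coordinates S is upper triangular with diagonal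
     1 / q and 1, and with t above the diagonal. The new parameter is the growth rate of a at
     the symmetric equilibrium M l. On the half-plane A, b is positive, and so is the denominator
     of t. *)
  define A :: "(real^2) set" where "A = {x. x $ 1 + x $ 2 > 0}"
  define B :: "real set" where "B = {0<..}"
  define a b :: "real^2 \<Rightarrow> real" where "a x = (x $ 1 - x $ 2) / 2" and "b x = (x $ 1 + x $ 2) / 2" for x
  define c w M r0 \<Lambda> where "c l = 2 * V l + \<Sigma> l" and "w l = V l + 1 / V l"
    and "M l = mbar (V l) (\<Sigma> l)" and "r0 l = sqrt ((w l)\<^sup>2 + 4 * c l * V l)"
    and "\<Lambda> l = V l * (1 - 2 * M l) - 1 / V l" for l
  define r where "r x l = sqrt ((w l)\<^sup>2 + 4 * c l * (V l + \<Sigma> l * (a x)\<^sup>2))" for x l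
  define q where "q x l = sqrt (4 * V l * \<Sigma> l / (r x l + r0 l))" for x l
  define \<Phi>b where "\<Phi>b x l = c l * (b x)\<^sup>2 + w l * b x - V l - \<Sigma> l * (a x)\<^sup>2" for x l
  define t where "t x l = 4 * V l * a x / (w l + 2 * c l * b x + r x l)" for x l
  define \<Phi> :: "real^2 \<Rightarrow> real \<Rightarrow> real^2" where
    "\<Phi> x l = (\<chi> k. \<Phi>b x l + (if k = 1 then 1 else -1) * (a x * q x l))" for x l
  define S :: "real^2 \<Rightarrow> real \<Rightarrow> real^2^2" where
    "S x l = (\<chi> i j. (1 + (if i = j then 1 else -1) * (1 / q x l) + (if i = 1 then 1 else -1) * t x l) / 2)"
    for x l
  have pos: "V l > 0" "\<Sigma> l > 0" "c l > 0" "w l > 0" "(w l)\<^sup>2 + 4 * c l * V l > 0" "r0 l > 0"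
    "(w l)\<^sup>2 + 4 * c l * (V l + \<Sigma> l * (a x)\<^sup>2) > 0" "r x l > 0" 
    "4 * V l * \<Sigma> l / (r x l + r0 l) > 0" "q x l > 0" if "l > 0" for l x
  proof -
    show *: "V l > 0" "\<Sigma> l > 0" "c l > 0" "w l > 0"
      using V(2) \<Sigma>(2) that by (simp_all add: c_def w_def add_pos_pos)
    then show "(w l)\<^sup>2 + 4 * c l * V l > 0" "(w l)\<^sup>2 + 4 * c l * (V l + \<Sigma> l * (a x)\<^sup>2) > 0"
      by (simp_all add: add_pos_pos add_pos_nonneg)
    then show "r0 l > 0" "r x l > 0"
      by (simp_all add: r_def r0_def)
    with * show "4 * V l * \<Sigma> l / (r x l + r0 l) > 0"
      by simp
    then show "q x l > 0"
      by (simp add: q_def)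
  qed
  have denom_pos: "w l + 2 * c l * b x + r x l > 0" if "x \<in> A" "l > 0" for x l
    using that(1) pos[OF that(2)] by (simp add: A_def b_def add_pos_pos)
  have M: "c l * (M l)\<^sup>2 + w l * M l = V l" "2 * c l * M l + w l = r0 l" "M l > 0" if "l > 0" for l
    using mbar_properties[OF pos(1,2)[OF that]] unfolding c_def w_def M_def r0_def by simp_all
  have "open A"
    unfolding A_def by (intro open_Collect_less continuous_intros)
  moreover have "open B"
    by (simp add: B_def)
  ultimately have U: "open (A \<times> B)"
    by (rule open_Times)

  have sm_a: "smooth_on (A \<times> B) (\<lambda>p. a (fst p))" and sm_b: "smooth_on (A \<times> B) (\<lambda>p. b (fst p))"
    unfolding a_def b_def
    by (intro smooth_on_bounded_linear U bounded_linear_divide[THEN bounded_linear_compose]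
        bounded_linear_sub bounded_linear_add bounded_linear_compose[OF bounded_linear_vec_nth]
        bounded_linear_fst)+
  have sm_V: "smooth_on (A \<times> B) (\<lambda>p. V (snd p))" and sm_\<Sigma>: "smooth_on (A \<times> B) (\<lambda>p. \<Sigma> (snd p))"
    by (rule smooth_on_compose_linear[OF _ U bounded_linear_snd _ V(1)]
        smooth_on_compose_linear[OF _ U bounded_linear_snd _ \<Sigma>(1)]; auto simp: B_def)+
  have sm_w: "smooth_on (A \<times> B) (\<lambda>p. w (snd p))" and sm_c: "smooth_on (A \<times> B) (\<lambda>p. c (snd p))"
    unfolding w_def c_def by (intro smooth_intros U sm_V sm_\<Sigma>; auto simp: B_def pos)+
  have sm_r: "smooth_on (A \<times> B) (\<lambda>p. r (fst p) (snd p))"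
    and sm_r0: "smooth_on (A \<times> B) (\<lambda>p. r0 (snd p))"
    unfolding r_def r0_def
    by (intro smooth_intros U sm_V sm_\<Sigma> sm_w sm_c sm_a; auto simp: B_def pos)+
  have sm_q: "smooth_on (A \<times> B) (\<lambda>p. q (fst p) (snd p))"
    unfolding q_def
    by (intro smooth_intros U sm_V sm_\<Sigma> sm_r sm_r0; auto simp: B_def pos add_pos_pos)
  have sm_\<Phi>b: "smooth_on (A \<times> B) (\<lambda>p. \<Phi>b (fst p) (snd p))"
    unfolding \<Phi>b_def by (intro smooth_intros U sm_V sm_\<Sigma> sm_w sm_c sm_a sm_b)
  have sm_t: "smooth_on (A \<times> B) (\<lambda>p. t (fst p) (snd p))"
    unfolding t_def
    by (intro smooth_intros U sm_V sm_\<Sigma> sm_w sm_c sm_a sm_b sm_r; auto simp: B_def denom_pos)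
  have sm_\<Phi>: "smooth_on (A \<times> B) (\<lambda>(x, l). \<Phi> x l)"
    unfolding \<Phi>_def case_prod_unfold by (intro smooth_intros U sm_\<Phi>b sm_a sm_q)
  have sm_S: "smooth_on (A \<times> B) (\<lambda>(x, l). S x l)"
    unfolding S_def case_prod_unfold 
    by (intro smooth_intros U sm_t sm_q; auto simp: B_def pos)
  have sm_M: "smooth_on B M"
    unfolding M_def mbar_def using V(1) \<Sigma>(1)
    by (intro smooth_intros \<open>open B\<close>)
      (auto simp: B_def pos intro!: add_pos_pos mult_pos_pos zero_less_power)
  have sm_\<Lambda>: "smooth_on B \<Lambda>"
    unfolding \<Lambda>_def using V(1) \<Sigma>(1)
    by (intro smooth_intros sm_M \<open>open B\<close>; auto simp: B_def pos)

  define m where "m = mbar v \<sigma>"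
  define x0 :: "real^2" where "x0 = m *\<^sub>R 1"
  have m: "M l0 = m" "m > 0" "m = (v\<^sup>2 - 1) / (2 * v\<^sup>2)"
    using l0 M(3)[OF l0(1)] mbar_critical[OF crit] by (simp_all add: M_def m_def)
  have x0: "x0 \<in> A" "a x0 = 0" "b x0 = m"
    using m by (simp_all add: x0_def A_def a_def b_def)
  have \<Phi>_x0: "\<Phi> x0 l0 = 0"
    using M(1)[OF l0(1)] x0 m by (simp add: \<Phi>_def vec_eq_iff \<Phi>b_def)
  have \<Lambda>_l0: "\<Lambda> l0 = 0"
    using v by (simp add: \<Lambda>_def l0 m(1)) (simp add: m(3) field_simps power2_eq_square)

  have deriv_\<Lambda>: "deriv \<Lambda> l0 > 0"
  proof -
    have "M differentiable (at l0)"
      using smooth_on_imp_has_derivative[OF sm_M, of l0] l0(1) by (auto simp: B_def differentiable_def)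
    then obtain M' where M': "(M has_real_derivative M') (at l0)"
      using real_differentiableE by blast
    (* M' is determined by differentiating the equation of the equilibrium. *)
    let ?L = "V' * (1 - 2 * m) - 2 * v * M' + V' / v\<^sup>2"
    have "(\<Lambda> has_real_derivative ?L) (at l0)"
      unfolding \<Lambda>_def
      using v by (auto intro!: derivative_eq_intros V'(1) M' simp: l0 m(1) power2_eq_square field_simps)
    have "((\<lambda>l. c l * (M l)\<^sup>2 + w l * M l - V l) has_real_derivative
        ((2 * V' + \<Sigma>') * m\<^sup>2 + c l0 * (2 * m * M') + (V' - V' / v\<^sup>2) * m + w l0 * M' - V')) (at l0)"
      unfolding c_def w_def
      using v by (auto intro!: derivative_eq_intros V'(1) \<Sigma>'(1) M' simp: l0 m(1) power2_eq_square field_simps)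
    moreover have "((\<lambda>l. c l * (M l)\<^sup>2 + w l * M l - V l) has_real_derivative 0) (at l0)"
      by (rule has_field_derivative_transform_within_open[OF DERIV_const[of 0] \<open>open B\<close>])
        (use l0(1) M(1) in \<open>auto simp: B_def\<close>)
    ultimately have *: "(2 * V' + \<Sigma>') * m\<^sup>2 + c l0 * (2 * m * M') + (V' - V' / v\<^sup>2) * m + w l0 * M' - V' = 0"
      by (rule DERIV_unique)
    have combination: "V' * x + \<Sigma>' * y > 0" if "x > 0" "y > 0" for x y
      using V'(2) \<Sigma>'(2) increasing that
      by (cases "V' = 0") (auto intro!: add_pos_nonneg)
    define e where "e = 2 * c l0 * m + w l0"
    have "e > 0"
      using M(2)[OF l0(1)] pos[OF l0(1)] m(1) by (simp add: e_def)
    have "e * M' = V' * (1 - (1 - 1 / v\<^sup>2) * m - 2 * m\<^sup>2) - \<Sigma>' * m\<^sup>2"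
      using * by (simp add: e_def algebra_simps)
    moreover have "e * ?L = V' * (e * (1 - 2 * m + 1 / v\<^sup>2)) - 2 * v * (e * M')"
      by (simp add: algebra_simps)
    ultimately have "e * ?L = V' * (e * (1 - 2 * m + 1 / v\<^sup>2) - 2 * v * (1 - (1 - 1 / v\<^sup>2) * m - 2 * m\<^sup>2))
        + \<Sigma>' * (2 * v * m\<^sup>2)"
      by (simp only:) (simp add: algebra_simps)
    moreover have "e * (1 - 2 * m + 1 / v\<^sup>2) - 2 * v * (1 - (1 - 1 / v\<^sup>2) * m - 2 * m\<^sup>2) > 0"
      using pitchfork_speed[OF crit] by (simp add: e_def m_def c_def w_def l0)
    moreover have "2 * v * m\<^sup>2 > 0"
      using v(1) m(2) by simp
    ultimately have "e * ?L > 0"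
      using combination by (simp only:)
    then have "?L > 0"
      using \<open>e > 0\<close> zero_less_mult_pos by blast
    with \<open>(\<Lambda> has_real_derivative ?L) (at l0)\<close> show ?thesis
      by (simp add: DERIV_imp_deriv)
  qed

  have S_x0: "S x0 l0 \<in> equivariant_GL0 S2"
  proof -
    let ?k = "1 / q x0 l0"
    have "S x0 l0 = sym2 ((1 + ?k) / 2) ((1 - ?k) / 2)"
      by (simp add: S_def sym2_def t_def x0 vec_eq_iff)
    also have "\<dots> \<in> equivariant_GL0 S2"
      using pos[OF l0(1)] by (intro sym2_in_equivariant_GL0) (simp_all flip: add_divide_distrib diff_divide_distrib)
    finally show ?thesis .
  qed

  have J_x0: "jacobian (\<lambda>x. \<Phi> x l0) (at x0) \<in> equivariant_GL0 S2"
  proof -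
    let ?k = "q x0 l0"
    define e where "e = 2 * c l0 * m + w l0"
    have "e > 0"
      using M(2)[OF l0(1)] pos[OF l0(1)] m(1) by (simp add: e_def)
    (* The derivative of q is not needed, as q is multiplied by a, which vanishes at x0. *)
    obtain Q' where Q': "((\<lambda>p. q (fst p) (snd p)) has_derivative Q') (at (x0, l0))"
      using smooth_on_imp_has_derivative[OF sm_q, of "(x0, l0)"] x0 l0(1) by (auto simp: B_def)
    have q': "((\<lambda>x. q x l0) has_derivative (\<lambda>h. Q' (h, 0))) (at x0)"
      using has_derivative_compose[OF
          has_derivative_Pair[OF has_derivative_ident has_derivative_const[of l0]] Q']
      by simp
    have a': "(a has_derivative a) (at x0)" and b': "(b has_derivative b) (at x0)"
      unfolding a_def b_def
      by (intro bounded_linear_imp_has_derivative bounded_linear_divide[THEN bounded_linear_compose]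
        bounded_linear_sub bounded_linear_add bounded_linear_vec_nth)+
    have \<Phi>b': "((\<lambda>x. \<Phi>b x l0) has_derivative (\<lambda>h. e * b h)) (at x0)"
      unfolding \<Phi>b_def
      by (rule derivative_eq_intros a' b' refl)+ (simp add: x0 e_def fun_eq_iff algebra_simps)
    have aq': "((\<lambda>x. a x * q x l0) has_derivative (\<lambda>h. a h * ?k)) (at x0)"
      using has_derivative_mult[OF a' q'] by (simp add: x0)
    have "((\<lambda>x. \<Phi> x l0) has_derivative (\<lambda>h. sym2 ((e + ?k) / 2) ((e - ?k) / 2) *v h)) (at x0)"
    proof (rule has_derivative_vecI)
      fix k :: 2
      show "((\<lambda>x. \<Phi> x l0 $ k) has_derivative (\<lambda>h. (sym2 ((e + ?k) / 2) ((e - ?k) / 2) *v h) $ k)) (at x0)"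
      proof -
        have "((\<lambda>x. \<Phi> x l0 $ k) has_derivative
            (\<lambda>h. e * b h + (if k = 1 then 1 else -1) * (a h * ?k))) (at x0)"
          unfolding \<Phi>_def vec_lambda_beta
          by (intro has_derivative_add \<Phi>b' has_derivative_mult_right aq')
        moreover have "e * b h + (if k = 1 then 1 else -1) * (a h * ?k) =
            (sym2 ((e + ?k) / 2) ((e - ?k) / 2) *v h) $ k" for h
          using exhaust_2[of k]
          by (auto simp: a_def b_def sym2_def matrix_vector_mult_def UNIV_2 field_simps)
        ultimately show ?thesis
          by simp
      qed
    qed
    from frechet_derivative_at[OF this]
    have "jacobian (\<lambda>x. \<Phi> x l0) (at x0) = sym2 ((e + ?k) / 2) ((e - ?k) / 2)"
      unfolding jacobian_def by (metis matrix_of_matrix_vector_mul)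
    also have "\<dots> \<in> equivariant_GL0 S2"
      using pos[OF l0(1)] \<open>e > 0\<close>
      by (intro sym2_in_equivariant_GL0) (simp_all flip: add_divide_distrib diff_divide_distrib)
    finally show ?thesis .
  qed

  have equivariant: "\<gamma> *v x \<in> A \<and> (\<forall>l\<in>B. \<Phi> (\<gamma> *v x) l = \<gamma> *v \<Phi> x l \<and> S (\<gamma> *v x) l ** \<gamma> = \<gamma> ** S x l)"
    if "\<gamma> \<in> S2" "x \<in> A" for \<gamma> x
  proof (cases "\<gamma> = mat 1")
    case True
    then show ?thesis using that by simp
  next
    case False
    define \<rho> :: "real^2^2" where "\<rho> = vector [vector [0, 1], vector [1, 0]]"
    have [simp]: "\<gamma> = \<rho>"
      using that False by (simp add: S2_def \<rho>_def)
    have \<rho>: "(\<rho> *v y) $ 1 = y $ 2" "(\<rho> *v y) $ 2 = y $ 1" for y :: "real^2"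
      by (simp_all add: \<rho>_def matrix_vector_mult_def UNIV_2)
    have \<rho>_nth: "\<rho> $ 1 $ 1 = 0" "\<rho> $ 1 $ 2 = 1" "\<rho> $ 2 $ 1 = 1" "\<rho> $ 2 $ 2 = 0"
      by (simp_all add: \<rho>_def)
    have ab: "a (\<rho> *v x) = - a x" "b (\<rho> *v x) = b x"
      by (simp_all add: a_def b_def \<rho> field_simps)
    have r: "r (\<rho> *v x) l = r x l" for l
      by (simp add: r_def ab)
    have q: "q (\<rho> *v x) l = q x l" "t (\<rho> *v x) l = - t x l" "\<Phi>b (\<rho> *v x) l = \<Phi>b x l" for l
      by (simp_all add: q_def t_def \<Phi>b_def ab r)
    have "\<rho> *v x \<in> A"
      using that(2) by (simp add: A_def \<rho> add.commute)
    moreover have "\<Phi> (\<rho> *v x) l = \<rho> *v \<Phi> x l" for l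
      by (simp add: vec_eq_iff forall_2 \<rho> \<Phi>_def q ab)
    moreover have "S (\<rho> *v x) l ** \<rho> = \<rho> ** S x l" for l
      by (simp add: vec_eq_iff forall_2 S_def q \<rho>_nth matrix_matrix_mult_def UNIV_2)
    ultimately show ?thesis by simp
  qed

  have factor: "seeley (\<Sigma> l) x (V l *\<^sub>R 1) = S x l *v pitchfork_nf (\<Phi> x l) (\<Lambda> l)"
    if "x \<in> A" "l \<in> B" for x l
  proof -
    have l: "l > 0" using that by (simp add: B_def)
    define ha where "ha = a x * q x l * (\<Lambda> l - (a x * q x l)\<^sup>2)"
    have nf: "pitchfork_nf (\<Phi> x l) (\<Lambda> l) = (\<chi> k. (if k = 1 then 1 else -1) * ha - \<Phi>b x l)"
      by (simp add: pitchfork_nf_def Let_def \<Phi>_def vec_eq_iff forall_2 ha_def)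
    have "S x l *v pitchfork_nf (\<Phi> x l) (\<Lambda> l) =
        (\<chi> k. (if k = 1 then 1 else -1) * (1 / q x l * ha - t x l * \<Phi>b x l) - \<Phi>b x l)"
      unfolding nf
      by (simp add: S_def matrix_vector_mult_def UNIV_2 vec_eq_iff forall_2 add_divide_distrib
          diff_divide_distrib algebra_simps)
    also have "1 / q x l * ha = a x * (\<Lambda> l - (a x)\<^sup>2 * (q x l)\<^sup>2)"
      using pos(10)[OF l, of x] by (simp add: ha_def power_mult_distrib)
    also have "(q x l)\<^sup>2 = 4 * V l * \<Sigma> l / (r x l + r0 l)"
      using pos(9)[OF l, of x] by (simp add: q_def)
    also have "a x * (\<Lambda> l - (a x)\<^sup>2 * (4 * V l * \<Sigma> l / (r x l + r0 l))) - t x l * \<Phi>b x l =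
       a x * (\<Lambda> l - (a x)\<^sup>2 * (4 * V l * \<Sigma> l / (r x l + r0 l)) - 
         4 * V l / (w l + 2 * c l * b x + r x l) * \<Phi>b x l)"
      by (simp add: t_def algebra_simps)
    also have "\<Lambda> l - (a x)\<^sup>2 * (4 * V l * \<Sigma> l / (r x l + r0 l)) - 
         4 * V l / (w l + 2 * c l * b x + r x l) * \<Phi>b x l = V l * (1 - 2 * b x) - 1 / V l"
      unfolding \<Lambda>_def \<Phi>b_def 
      by (rule pitchfork_factorization)
        (use that pos[OF l] M(2)[OF l] in \<open>auto simp: c_def w_def A_def b_def r_def r0_def\<close>)
    finally show ?thesis
      using pos(1)[OF l]
      by (simp add: vec_eq_iff forall_2 seeley_uniform \<Phi>b_def a_def b_def c_def w_def)
        (simp add: field_simps power2_eq_square)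
  qed

  show ?thesis
    unfolding S2_pitchfork_def bifurcation_equiv_def m_def[symmetric] x0_def[symmetric]
    by (rule exI[of _ A], rule exI[of _ B], rule exI[of _ \<Phi>], rule exI[of _ \<Lambda>], rule exI[of _ S])
      (use \<open>open A\<close> \<open>open B\<close> x0 l0(1) sm_\<Phi> sm_\<Lambda> sm_S \<Phi>_x0 \<Lambda>_l0 deriv_\<Lambda> J_x0 S_x0 equivariant factor
        in \<open>simp add: B_def\<close>)
qed

section \<open>The unfolding\<close>

lemma smooth_on_tree_field:
  fixes y :: "'a::real_normed_vector \<Rightarrow> real^('i::finite \<times> 2)"
  assumes "open U" "bounded_linear m" "smooth_on U s"
    and "\<And>c. smooth_on U (\<lambda>p. y p $ c)" "\<And>p c. p \<in> U \<Longrightarrow> y p $ c > 0"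
  shows "smooth_on U (\<lambda>p. tree_field (s p) (m p) (y p))"
proof -
  have "smooth_on U (\<lambda>p. m p $ c)" for c
    by (intro smooth_on_bounded_linear assms bounded_linear_compose[OF bounded_linear_vec_nth])
  then show ?thesis
    unfolding tree_field_def seeley_def block_def Let_def using assms
    by (simp, intro smooth_intros) auto
qed

lemma pitchfork_copies_uniform:
  fixes T :: "('i::finite, 'l::finite, 'o::finite) parsing"
  assumes T: "is_parsing T"
    and "S2_pitchfork (\<lambda>m l. seeley (\<sigma> l) m (y l *\<^sub>R 1)) (b *\<^sub>R 1) l0"
  shows "equivariant_pitchfork_copies T
    (\<lambda>m l. tree_field (\<sigma> l) m (value_vec T (y l *\<^sub>R 1))) (b *\<^sub>R 1) l0"
  unfolding equivariant_pitchfork_copies_def value_vec_uniform[OF T]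
proof (intro conjI exI allI)
  show "tree_equivariant T (\<lambda>m l. tree_field (\<sigma> l) m (y l *\<^sub>R 1))"
    by (rule tree_equivariant_uniform[OF T])
  fix i
  have block_scaleR: "block i (z *\<^sub>R 1) = z *\<^sub>R 1" for z
    by (simp add: block_def vec_eq_iff)
  show "block i (tree_field (\<sigma> l) m (y l *\<^sub>R 1)) = seeley (\<sigma> l) (block i m) (y l *\<^sub>R 1)" for m l
    by (simp add: tree_field_def block_def[of i "\<chi> c. _ c"] block_scaleR vec_eq_iff)
  show "S2_pitchfork (\<lambda>m l. seeley (\<sigma> l) m (y l *\<^sub>R 1)) (block i (b *\<^sub>R 1)) l0"
    unfolding block_scaleR by (rule assms(2))
qed

text \<open>The family obtained from the tree dynamics by writing the values in terms of the value of the
  root (the first component of \<open>p\<close>) and the unfolding parameters; the second component of \<open>p\<close>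
  is $\sigma$.\<close>

definition tree_unfolding ::
    "('i::finite, 'l, 'o) parsing \<Rightarrow> real^('i \<times> 2) \<Rightarrow> real \<times> real \<Rightarrow> real^'i \<Rightarrow> real^('i \<times> 2)" where
  "tree_unfolding T m p \<alpha> = tree_field (snd p) m (\<chi> c. fst p * node_ratio T \<alpha> (child T c))"

lemma unfolding_on_tree_unfolding:
  fixes T :: "('i::finite, 'l::finite, 'o::finite) parsing"
  assumes T: "is_parsing T"
  shows "unfolding_on ({0<..} \<times> {0<..}) {\<alpha>. \<forall>i. \<bar>\<alpha> $ i\<bar> < 2}
    (\<lambda>m (y, s). tree_field s m (value_vec T (y *\<^sub>R 1))) (tree_unfolding T)"
proof -
  let ?A = "{\<alpha> :: real^'i. \<forall>i. \<bar>\<alpha> $ i\<bar> < 2}"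
  let ?U = "(UNIV :: (real^('i \<times> 2)) set) \<times> ({0<..} \<times> {0<..} :: (real \<times> real) set) \<times> ?A"
  have A: "open ?A"
  proof -
    have "?A = (\<Inter>i. {\<alpha>. \<bar>\<alpha> $ i\<bar> < 2})" by auto
    also have "open \<dots>"
      by (intro open_INT ballI finite open_Collect_less continuous_intros)
    finally show ?thesis .
  qed
  have L: "open ({0<..} \<times> {0<..} :: (real \<times> real) set)"
    by (simp add: open_Times)
  have U: "open ?U"
    by (intro open_Times open_UNIV L A)
  have "smooth_on ?U (\<lambda>p. tree_field (snd (fst (snd p))) (fst p)
      (\<chi> c. fst (fst (snd p)) * node_ratio T (snd (snd p)) (child T c)))"
  proof (rule smooth_on_tree_field[OF U])
    show "smooth_on ?U (\<lambda>p. (\<chi> c. fst (fst (snd p)) * node_ratio T (snd (snd p)) (child T c)) $ c)" for c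
      by (simp, intro smooth_on_mult U smooth_on_node_ratio[OF T U] smooth_on_bounded_linear[OF U]
        bounded_linear_compose[OF bounded_linear_fst] bounded_linear_compose[OF bounded_linear_snd]
        bounded_linear_fst bounded_linear_snd)
  qed (auto intro!: smooth_on_bounded_linear[OF U] bounded_linear_fst bounded_linear_snd
      bounded_linear_compose[OF bounded_linear_fst] bounded_linear_compose[OF bounded_linear_snd]
      mult_pos_pos node_ratio_pos[OF T])
  then have "smooth_on ?U (\<lambda>(x, l, \<alpha>). tree_unfolding T x l \<alpha>)"
    by (simp add: tree_unfolding_def case_prod_unfold)
  moreover have "tree_unfolding T x (y, s) 0 = tree_field s x (value_vec T (y *\<^sub>R 1))" for x y s
    unfolding value_vec_uniform[OF T] tree_unfolding_def node_ratio_zero[OF T]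
    by (simp add: vec_eq_iff[symmetric] scaleR_vec_def one_vec_def)
  ultimately show ?thesis
    using A L by (simp add: unfolding_on_def case_prod_beta)
qed

lemma tree_field_eq_tree_unfolding:
  fixes T :: "('i::finite, 'l::finite, 'o::finite) parsing"
  assumes T: "is_parsing T" and "\<forall>j. w $ j > 0"
  shows "tree_field s m (value_vec T w) =
    tree_unfolding T m (node_value T w (root_node T), s) (alpha T w)"
  using node_value_eq_ratio[OF assms, symmetric] by (simp add: tree_unfolding_def value_vec_def)

theorem theorem5p3:
  fixes T :: "('i::finite, 'l::finite, 'o::finite) parsing" and v :: real
  assumes "is_parsing T" and "CARD('o) \<ge> 2" and "v > 1"
  shows
    "(\<forall>\<sigma>>0. mbar v \<sigma> *\<^sub>R 1 \<in> (state_space :: (real^('i \<times> 2)) set) \<and>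
        tree_field \<sigma> (mbar v \<sigma> *\<^sub>R 1) (value_vec T (v *\<^sub>R 1)) = 0) \<and>
     (\<forall>\<sigma>. \<sigma> = 4 * v^3 / (v^2 - 1)^2 \<longrightarrow>
        singularity (\<lambda>m. tree_field \<sigma> m (value_vec T (v *\<^sub>R 1))) (mbar v \<sigma> *\<^sub>R 1) \<and>
        equivariant_pitchfork_copies T
          (\<lambda>m s. tree_field s m (value_vec T (v *\<^sub>R 1))) (mbar v \<sigma> *\<^sub>R 1) \<sigma> \<and>
        equivariant_pitchfork_copies T
          (\<lambda>m y. tree_field \<sigma> m (value_vec T (y *\<^sub>R 1))) (mbar v \<sigma> *\<^sub>R 1) v) \<and>
     CARD('i) = CARD('o) - 1 \<and>
     (\<exists>F :: real^('i \<times> 2) \<Rightarrow> real \<times> real \<Rightarrow> real^'i \<Rightarrow> real^('i \<times> 2).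
        unfolding_on ({0<..} \<times> {0<..}) {\<alpha>. \<forall>i. \<bar>\<alpha> $ i\<bar> < 2}
          (\<lambda>m (y, s). tree_field s m (value_vec T (y *\<^sub>R 1))) F \<and>
        (\<forall>w. (\<forall>j. w $ j > 0) \<longrightarrow>
           (\<forall>m. \<forall>s>0. tree_field s m (value_vec T w) =
              F m (node_value T w (root_node T), s) (alpha T w))) \<and>
        bij_betw (\<lambda>w. (node_value T w (root_node T), alpha T w))
          {w. \<forall>j. w $ j > 0} ({0<..} \<times> {\<alpha>. \<forall>i. \<bar>\<alpha> $ i\<bar> < 2}))"
proof (intro conjI allI impI)
  note T = assms(1)
  have v: "v > 0" "v\<^sup>2 > 1"
    using assms(3) one_less_power[of v 2] by auto
  have id: "smooth_on {0<..} (\<lambda>l::real. l)"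
    by (intro smooth_on_bounded_linear bounded_linear_ident open_greaterThan)
  have const: "smooth_on {0<..} (\<lambda>l::real. z)" for z :: real
    by (intro smooth_on_const open_greaterThan)
  show "mbar v \<sigma> *\<^sub>R 1 \<in> (state_space :: (real^('i \<times> 2)) set)" if "\<sigma> > 0" for \<sigma>
    by (rule mbar_in_state_space[OF v(1) that])
  show "tree_field \<sigma> (mbar v \<sigma> *\<^sub>R 1) (value_vec T (v *\<^sub>R 1)) = 0" if "\<sigma> > 0" for \<sigma>
    unfolding value_vec_uniform[OF T] by (rule tree_field_mbar[OF v(1) that])
  show "CARD('i) = CARD('o) - 1"
    by (rule card_internal[OF T])
  {
    fix \<sigma> :: real assume \<sigma>: "\<sigma> = 4 * v^3 / (v^2 - 1)^2"
    then have \<sigma>_pos: "\<sigma> > 0"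
      using v by simp
    show "singularity (\<lambda>m. tree_field \<sigma> m (value_vec T (v *\<^sub>R 1))) (mbar v \<sigma> *\<^sub>R 1)"
      unfolding value_vec_uniform[OF T] by (rule singularity_mbar[OF assms(3) \<sigma>])
    show "equivariant_pitchfork_copies T
        (\<lambda>m s. tree_field s m (value_vec T (v *\<^sub>R 1))) (mbar v \<sigma> *\<^sub>R 1) \<sigma>"
      by (intro pitchfork_copies_uniform[OF T]
          S2_pitchfork_seeley[OF const _ id _ \<sigma>_pos refl refl assms(3) \<sigma> DERIV_const _ DERIV_ident])
        (use v in simp_all)
    show "equivariant_pitchfork_copies T
        (\<lambda>m y. tree_field \<sigma> m (value_vec T (y *\<^sub>R 1))) (mbar v \<sigma> *\<^sub>R 1) v"
      by (intro pitchfork_copies_uniform[OF T]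
          S2_pitchfork_seeley[OF id _ const _ v(1) refl refl assms(3) \<sigma> DERIV_ident _ DERIV_const])
        (use \<sigma>_pos in simp_all)
  }
  show "\<exists>F :: real^('i \<times> 2) \<Rightarrow> real \<times> real \<Rightarrow> real^'i \<Rightarrow> real^('i \<times> 2).
        unfolding_on ({0<..} \<times> {0<..}) {\<alpha>. \<forall>i. \<bar>\<alpha> $ i\<bar> < 2}
          (\<lambda>m (y, s). tree_field s m (value_vec T (y *\<^sub>R 1))) F \<and>
        (\<forall>w. (\<forall>j. w $ j > 0) \<longrightarrow>
           (\<forall>m. \<forall>s>0. tree_field s m (value_vec T w) =
              F m (node_value T w (root_node T), s) (alpha T w))) \<and>
        bij_betw (\<lambda>w. (node_value T w (root_node T), alpha T w))
          {w. \<forall>j. w $ j > 0} ({0<..} \<times> {\<alpha>. \<forall>i. \<bar>\<alpha> $ i\<bar> < 2})"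
    using unfolding_on_tree_unfolding[OF T] tree_field_eq_tree_unfolding[OF T]
      bij_betw_root_alpha[OF T]
    by (intro exI[of _ "tree_unfolding T"]) simp
qed

end
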